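(* There is a universal constant $C>0$ such that the following is true. Take any $n\ge 1$ and any nonempty closed convex set $K\subseteq\mathbb{R}^n$. Let $g:\mathbb{R}^n\to\mathbb{R}^n$ be any Borel measurable map, let $Z$ be an $n$-dimensional standard Gaussian random vector, and for each $\mu\in\mathbb{R}^n$ define $\tilde\mu:=g(Z+\mu)$ and $\hat\mu:=P_K(Z+\mu)$. Then there exists $\mu\in K$ such that $$\mathbb{E}\|\tilde\mu-\mu\|^2\ge C\,\mathbb{E}\|\hat\mu-\mu\|^2 .$$
   Context: $\|\cdot\|$ is the Euclidean norm on $\mathbb{R}^n$. For a nonempty closed convex set $K\subseteq\mathbb{R}^n$, $P_K(x)$ denotes the unique point of $K$ closest to $x$ in Euclidean distance. "Universal" means that $C$ does not depend on $n$, $K$ or $g$. Expectations of nonnegative random variables take values in $[0,\infty]$. *)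

theory Defs
  imports "HOL-Probability.Probability"
begin

text \<open>
  The constant of the theorem must not depend on the dimension, so \<open>n\<close> has to be an ordinary
  bound variable and cannot be encoded in a type such as \<^typ>\<open>real ^ 'n\<close>. A vector of
  Euclidean \<open>n\<close>-space is therefore a function on the index set \<open>{..<n}\<close>, extended by
  \<^const>\<open>undefined\<close>. These are exactly the points of the library's finite product
  topologies and finite product measures over \<open>{..<n}\<close>. The Euclidean norm of such a vector is
  \<open>L2_set x {..<n}\<close>.
\<close>

definition rspace :: "nat \<Rightarrow> (nat \<Rightarrow> real) set" where
  "rspace n = ({..<n} \<rightarrow>\<^sub>E UNIV)"

definition vadd :: "nat \<Rightarrow> (nat \<Rightarrow> real) \<Rightarrow> (nat \<Rightarrow> real) \<Rightarrow> (nat \<Rightarrow> real)" where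
  "vadd n x y = (\<lambda>i\<in>{..<n}. x i + y i)"

definition vminus :: "nat \<Rightarrow> (nat \<Rightarrow> real) \<Rightarrow> (nat \<Rightarrow> real) \<Rightarrow> (nat \<Rightarrow> real)" where
  "vminus n x y = (\<lambda>i\<in>{..<n}. x i - y i)"

definition vscale :: "nat \<Rightarrow> real \<Rightarrow> (nat \<Rightarrow> real) \<Rightarrow> (nat \<Rightarrow> real)" where
  "vscale n c x = (\<lambda>i\<in>{..<n}. c * x i)"

definition enorm :: "nat \<Rightarrow> (nat \<Rightarrow> real) \<Rightarrow> real" where
  "enorm n x = L2_set x {..<n}"

definition rtop :: "nat \<Rightarrow> (nat \<Rightarrow> real) topology" where
  "rtop n = product_topology (\<lambda>_. euclideanreal) {..<n}"

definition rborel :: "nat \<Rightarrow> (nat \<Rightarrow> real) measure" where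
  "rborel n = (\<Pi>\<^sub>M i\<in>{..<n}. borel)"

definition std_gaussian :: "nat \<Rightarrow> (nat \<Rightarrow> real) measure" where
  "std_gaussian n = (\<Pi>\<^sub>M i\<in>{..<n}. density lborel (\<lambda>t. ennreal (std_normal_density t)))"

definition rconvex :: "nat \<Rightarrow> (nat \<Rightarrow> real) set \<Rightarrow> bool" where
  "rconvex n K \<longleftrightarrow>
     (\<forall>x\<in>K. \<forall>y\<in>K. \<forall>u\<ge>0. \<forall>v\<ge>0. u + v = 1 \<longrightarrow> vadd n (vscale n u x) (vscale n v y) \<in> K)"

text \<open>Meaningful only when \<open>K\<close> is a nonempty closed convex subset of \<open>rspace n\<close>, where the
  closest point exists and is unique.\<close>

definition proj :: "nat \<Rightarrow> (nat \<Rightarrow> real) set \<Rightarrow> (nat \<Rightarrow> real) \<Rightarrow> (nat \<Rightarrow> real)" where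
  "proj n K x = (THE p. p \<in> K \<and> (\<forall>y\<in>K. enorm n (vminus n x p) \<le> enorm n (vminus n x y)))"

lemma topspace_rtop: "topspace (rtop n) = rspace n"
  by (simp add: rtop_def rspace_def)

lemma space_rborel: "space (rborel n) = rspace n"
  by (simp add: rborel_def rspace_def space_PiM)

text \<open>The product sigma-algebra is the sigma-algebra generated by the open sets.\<close>

lemma sets_rborel: "sets (rborel n) = sigma_sets (rspace n) {U. openin (rtop n) U}"
proof
  show "sets (rborel n) \<subseteq> sigma_sets (rspace n) {U. openin (rtop n) U}"
  proof -
    let ?S = "sigma (rspace n) {U. openin (rtop n) U}"
    have sub: "{U. openin (rtop n) U} \<subseteq> Pow (rspace n)"
      using openin_subset topspace_rtop by blast
    then have S: "sets ?S = sigma_sets (rspace n) {U. openin (rtop n) U}" "space ?S = rspace n"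
      by (auto simp: space_measure_of_conv)
    have coord: "(\<lambda>x. x i) \<in> borel_measurable ?S" if "i < n" for i
    proof (rule borel_measurableI)
      fix T :: "real set" assume "open T"
      have "continuous_map (rtop n) euclideanreal (\<lambda>x. x i)"
        unfolding rtop_def using that by (intro continuous_map_product_projection) auto
      then have "openin (rtop n) {x \<in> topspace (rtop n). x i \<in> T}"
        using \<open>open T\<close> by (intro openin_continuous_map_preimage) auto
      moreover have "{x \<in> topspace (rtop n). x i \<in> T} = (\<lambda>x. x i) -` T \<inter> space ?S"
        unfolding S(2) topspace_rtop by auto
      ultimately show "(\<lambda>x. x i) -` T \<inter> space ?S \<in> sets ?S"
        unfolding S(1) by auto
    qed
    have "(\<lambda>x. x) \<in> measurable ?S (rborel n)"
      unfolding rborel_def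
    proof (rule measurable_PiM_single')
      show "(\<lambda>x. x i) \<in> borel_measurable ?S" if "i \<in> {..<n}" for i
        using coord that by auto
      show "(\<lambda>x i. x i) \<in> space ?S \<rightarrow> ({..<n} \<rightarrow>\<^sub>E space borel)"
        unfolding S(2) by (auto simp: rspace_def)
    qed
    then have "\<And>A. A \<in> sets (rborel n) \<Longrightarrow> (\<lambda>x. x) -` A \<inter> space ?S \<in> sets ?S"
      by (rule measurable_sets)
    moreover have "(\<lambda>x. x) -` A \<inter> space ?S = A" if "A \<in> sets (rborel n)" for A
      using sets.sets_into_space[OF that] by (auto simp: S(2) space_rborel)
    ultimately show ?thesis
      unfolding S(1) by auto
  qed
next
  obtain B :: "real set set" where B: "countable B" "topological_basis B"
    using ex_countable_basis by blast
  have "U \<in> sets (rborel n)" if U: "openin (rtop n) U" for U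
  proof -
    let ?F = "{W \<in> {..<n} \<rightarrow>\<^sub>E B. Pi\<^sub>E {..<n} W \<subseteq> U}"
    have "countable ?F"
      by (rule countable_subset[OF _ countable_PiE[of "{..<n}" "\<lambda>_. B"]]) (use B in auto)
    moreover have "Pi\<^sub>E {..<n} W \<in> sets (rborel n)" if "W \<in> ?F" for W
    proof -
      have "open (W i)" if "i < n" for i
        using \<open>W \<in> ?F\<close> that topological_basis_open[OF B(2)] by (auto simp: PiE_iff)
      then show ?thesis
        unfolding rborel_def by (intro sets_PiM_I_finite) auto
    qed
    ultimately have "(\<Union>W\<in>?F. Pi\<^sub>E {..<n} W) \<in> sets (rborel n)"
      by (intro sets.countable_UN') auto
    moreover have "(\<Union>W\<in>?F. Pi\<^sub>E {..<n} W) = U"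
    proof
      show "U \<subseteq> (\<Union>W\<in>?F. Pi\<^sub>E {..<n} W)"
      proof
        fix x assume "x \<in> U"
        then obtain V where V: "\<forall>i\<in>{..<n}. open (V i)" "x \<in> Pi\<^sub>E {..<n} V" "Pi\<^sub>E {..<n} V \<subseteq> U"
          using U unfolding rtop_def openin_product_topology_alt by auto
        have "\<exists>b\<in>B. x i \<in> b \<and> b \<subseteq> V i" if "i < n" for i
        proof -
          have "open (V i)" "x i \<in> V i"
            using V(1,2) that by (auto simp: PiE_iff)
          then obtain b where "b \<in> B" "x i \<in> b" "b \<subseteq> V i"
            using topological_basisE[OF B(2)] by metis
          then show ?thesis by blast
        qed
        then obtain b where b: "\<And>i. i < n \<Longrightarrow> b i \<in> B \<and> x i \<in> b i \<and> b i \<subseteq> V i"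
          by metis
        let ?W = "restrict b {..<n}"
        have "Pi\<^sub>E {..<n} ?W \<subseteq> Pi\<^sub>E {..<n} V"
          by (rule PiE_mono) (use b in auto)
        moreover have "x \<in> Pi\<^sub>E {..<n} ?W"
          using b V(2) by (auto simp: PiE_iff)
        moreover have "?W \<in> {..<n} \<rightarrow>\<^sub>E B"
          using b by auto
        ultimately show "x \<in> (\<Union>W\<in>?F. Pi\<^sub>E {..<n} W)"
          using V(3) by (intro UN_I[of "restrict b {..<n}"]) (simp_all add: subset_trans)
      qed
    qed auto
    ultimately show ?thesis by simp
  qed
  then show "sigma_sets (rspace n) {U. openin (rtop n) U} \<subseteq> sets (rborel n)"
    by (subst space_rborel[symmetric], intro sets.sigma_sets_subset) auto
qed

end

theory Submission
  imports Defs
begin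

text \<open>
  Write \<open>P\<close> for the projection onto \<open>K\<close>. The proof is Bayesian: if some \<open>g\<close> had risk below
  \<open>1/524\<close> times the risk of \<open>P\<close> at every point of \<open>K\<close>, then a prior built around an arbitrary
  point \<open>\<mu>\<close> of \<open>K\<close> would show that a certain bounded functional on \<open>K\<close> exceeds its value at \<open>\<mu>\<close>
  somewhere, by at least a fixed multiple of the risk of \<open>P\<close> at \<open>\<mu>\<close>. This cannot go on for ever.

  The prior is the law of \<open>w = P (\<mu> + Z'/8)\<close>, with \<open>Z'\<close> a standard Gaussian vector independent of
  the noise \<open>Z\<close>. Equivalently, \<open>w\<close> maximises \<open>Z' \<bullet> (w - \<mu>) - 4 |w - \<mu>|\<^sup>2\<close> over \<open>K\<close>.
  The functional is the expected maximum \<open>gain \<mu>\<close>, and \<open>spread \<mu> = E |w - \<mu>|\<^sup>2\<close> is the scale of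
  the prior. Shrinking the noise changes scales by a bounded factor only: for
  every outcome \<open>|P (\<mu> + Z) - \<mu>| \<le> 8 |P (\<mu> + Z/8) - \<mu>|\<close> (\<open>sqdist_proj_le_shrunk\<close>), and
  \<open>P\<close> is nonexpansive, so the risk of \<open>P\<close> at a point drawn from the prior is controlled by \<open>spread \<mu>\<close>.

  Suppose that \<open>y = g (w + Z)\<close> estimated \<open>w\<close> well. The vector \<open>w\<close> is strongly correlated with
  \<open>Z'\<close>, so \<open>y\<close> would be too. But the data \<open>w + Z\<close> differ from the uninformative data \<open>\<mu> + Z\<close> by
  a relative entropy of \<open>spread \<mu> / 2\<close> at most, and for uninformative data \<open>y\<close> is independent
  of \<open>Z'\<close>. For a fixed value \<open>y \<in> K\<close> the relevant exponential moment is bounded by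
  \<open>exp (gain y)\<close> (\<open>exp_moment_shrunk_le\<close>); this is an instance of the dimension-free
  infimum-convolution inequality of Maurey for the Gaussian measure (\<open>tau_gaussian_on\<close>), whose
  one-dimensional case is a Prekopa-Leindler argument on level sets. Integrating over \<open>y\<close>, changing
  the measure by the translation \<open>Z \<mapsto> Z + w - \<mu>\<close> and applying Jensen's inequality twice gives
  \<open>gain \<mu> + spread \<mu> / 2 \<le> sup gain\<close> (\<open>gain_improvement\<close>). The factor \<open>8\<close> is there for this
  balance: it yields \<open>4 spread \<mu>\<close> on the side of the prior, which pays for \<open>spread \<mu>\<close> lost in the
  convolution inequality, \<open>spread \<mu> / 2\<close> lost in the translation and \<open>2 spread \<mu>\<close> for the
  assumed risk of \<open>g\<close>.

  Along a sequence that maximises \<open>gain\<close> the spread therefore tends to zero. Since a small spread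
  forces a small gain (\<open>gain_le\<close>), the supremum of \<open>gain\<close> is zero; then every spread is zero, \<open>P\<close>
  has no risk at all, and nothing has a smaller one.
\<close>

section \<open>The infimum-convolution inequality on the real line\<close>

text \<open>
  A set of reals is no larger than the interval between its infimum and supremum, and the
  endpoints of the two intervals add up to at most \<open>2 * r\<close> in absolute value.
\<close>

lemma add_emeasure_le_of_sums_bounded:
  fixes A B :: "real set"
  assumes "A \<noteq> {}" "B \<noteq> {}" and sum: "\<And>x y. x \<in> A \<Longrightarrow> y \<in> B \<Longrightarrow> \<bar>x + y\<bar> \<le> 2 * r"
  shows "emeasure lborel A + emeasure lborel B \<le> ennreal (4 * r)"
proof -
  obtain x0 y0 where x0: "x0 \<in> A" and y0: "y0 \<in> B" using assms by blast
  have bA: "bdd_above A" "bdd_below A"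
    using sum[OF _ y0] by (auto intro!: bdd_aboveI[of _ "2 * r - y0"] bdd_belowI[of _ "- 2 * r - y0"] simp: abs_le_iff)
      (smt (verit) sum y0)+
  have bB: "bdd_above B" "bdd_below B"
    using sum[OF x0] by (auto intro!: bdd_aboveI[of _ "2 * r - x0"] bdd_belowI[of _ "- 2 * r - x0"] simp: abs_le_iff)
      (smt (verit) sum x0)+
  have "Sup A \<le> 2 * r - Sup B"
  proof (rule cSup_least[OF assms(1)])
    fix x assume x: "x \<in> A"
    have "Sup B \<le> 2 * r - x"
      by (rule cSup_least[OF assms(2)]) (use sum[OF x] in \<open>smt (verit)\<close>)
    then show "x \<le> 2 * r - Sup B" by simp
  qed
  moreover have "- 2 * r - Inf B \<le> Inf A"
  proof (rule cInf_greatest[OF assms(1)])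
    fix x assume x: "x \<in> A"
    have "- 2 * r - x \<le> Inf B"
      by (rule cInf_greatest[OF assms(2)]) (use sum[OF x] in \<open>smt (verit)\<close>)
    then show "- 2 * r - Inf B \<le> x" by simp
  qed
  ultimately have le: "(Sup A - Inf A) + (Sup B - Inf B) \<le> 4 * r" by simp
  have *: "emeasure lborel S \<le> ennreal (Sup S - Inf S)" "0 \<le> Sup S - Inf S"
    if "bdd_above S" "bdd_below S" "S \<noteq> {}" for S :: "real set"
  proof -
    have le: "Inf S \<le> Sup S" using that by (simp add: cInf_le_cSup)
    have "S \<subseteq> {Inf S..Sup S}" using that by (auto intro: cInf_lower cSup_upper)
    then have "emeasure lborel S \<le> emeasure lborel {Inf S..Sup S}" by (rule emeasure_mono) simp
    then show "emeasure lborel S \<le> ennreal (Sup S - Inf S)" "0 \<le> Sup S - Inf S"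
      using le by simp_all
  qed
  have "emeasure lborel A + emeasure lborel B \<le> ennreal (Sup A - Inf A) + ennreal (Sup B - Inf B)"
    using *[OF bA assms(1)] *[OF bB assms(2)] by (intro add_mono) auto
  also have "\<dots> = ennreal ((Sup A - Inf A) + (Sup B - Inf B))"
    using *(2)[OF bA assms(1)] *(2)[OF bB assms(2)] by (simp add: ennreal_plus)
  also have "\<dots> \<le> ennreal (4 * r)" using le by (rule ennreal_leI)
  finally show ?thesis .
qed

lemma nn_integral_layer_cake:
  fixes f :: "real \<Rightarrow> real"
  assumes [measurable]: "f \<in> borel_measurable borel" and f0: "\<And>x. 0 \<le> f x"
  shows "(\<integral>\<^sup>+ x. ennreal (f x) \<partial>lborel)
    = (\<integral>\<^sup>+ t. indicator {0<..} t * emeasure lborel {x. t < f x} \<partial>lborel)"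
proof -
  have "(\<integral>\<^sup>+ x. ennreal (f x) \<partial>lborel) = (\<integral>\<^sup>+ x. (\<integral>\<^sup>+ t. indicator {0<..<f x} t \<partial>lborel) \<partial>lborel)"
    using f0 by (intro nn_integral_cong) simp
  also have "\<dots> = (\<integral>\<^sup>+ x. (\<integral>\<^sup>+ t. (if 0 < t \<and> t < f x then 1 else 0) \<partial>lborel) \<partial>lborel)"
    by (intro nn_integral_cong) (auto simp: indicator_def)
  also have "\<dots> = (\<integral>\<^sup>+ t. (\<integral>\<^sup>+ x. (if 0 < t \<and> t < f x then 1 else 0) \<partial>lborel) \<partial>lborel)"
    by (rule pair_sigma_finite.Fubini') (simp_all add: lborel_pair.pair_sigma_finite_axioms)
  also have "\<dots> = (\<integral>\<^sup>+ t. (\<integral>\<^sup>+ x. indicator {0<..} t * indicator {x. t < f x} x \<partial>lborel) \<partial>lborel)"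
    by (intro nn_integral_cong) (auto simp: indicator_def)
  also have "\<dots> = (\<integral>\<^sup>+ t. indicator {0<..} t * emeasure lborel {x. t < f x} \<partial>lborel)"
    by (intro nn_integral_cong) (simp add: nn_integral_cmult)
  finally show ?thesis .
qed

lemma gaussian_level_set:
  fixes c t :: real
  assumes "0 < t" "t < c"
  shows "{x. t < c * exp (- x\<^sup>2 / 2)} = {- sqrt (2 * ln (c / t))<..<sqrt (2 * ln (c / t))}"
proof -
  have "t < c * exp (- x\<^sup>2 / 2) \<longleftrightarrow> \<bar>x\<bar> < sqrt (2 * ln (c / t))" for x
  proof -
    have "t < c * exp (- x\<^sup>2 / 2) \<longleftrightarrow> exp (x\<^sup>2 / 2) < c / t"
      using assms by (simp add: exp_minus field_simps)
    also have "\<dots> \<longleftrightarrow> x\<^sup>2 / 2 < ln (c / t)"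
      using assms by (metis divide_pos_pos exp_less_cancel_iff exp_ln order_less_trans)
    also have "\<dots> \<longleftrightarrow> \<bar>x\<bar>\<^sup>2 < 2 * ln (c / t)" by auto
    also have "\<dots> \<longleftrightarrow> \<bar>x\<bar> < sqrt (2 * ln (c / t))"
      by (metis abs_ge_zero real_less_rsqrt real_sqrt_abs abs_abs real_sqrt_less_iff power2_abs)
    finally show ?thesis .
  qed
  then show ?thesis by (simp only: abs_less_iff greaterThanLessThan_def lessThan_def greaterThan_def) (simp add: set_eq_iff minus_less_iff conj_commute)
qed

text \<open>
  The sum of a point in the level set of \<open>a\<close> and a point in that of \<open>b\<close> is twice a point in the
  level set of the Gaussian, and the latter is a symmetric interval. The normalisation of the
  suprema to \<open>1\<close> makes both level sets nonempty at every height below \<open>1\<close>; without it, one of them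
  could be empty while the other is large, and the bound on the sum of the lengths would fail.
\<close>

lemma prekopa_leindler_gaussian_normalized:
  fixes a b :: "real \<Rightarrow> real"
  assumes [measurable]: "a \<in> borel_measurable borel" "b \<in> borel_measurable borel"
    and a0: "\<And>x. 0 \<le> a x" and b0: "\<And>x. 0 \<le> b x"
    and a1: "\<And>x. a x \<le> 1" and b1: "\<And>x. b x \<le> 1"
    and asup: "\<And>t. t < 1 \<Longrightarrow> \<exists>x. t < a x" and bsup: "\<And>t. t < 1 \<Longrightarrow> \<exists>x. t < b x"
    and c0: "0 \<le> c"
    and ab: "\<And>x y. a x * b y \<le> (c * exp (- ((x + y) / 2)\<^sup>2 / 2))\<^sup>2"
  shows "(\<integral>\<^sup>+ x. ennreal (a x) \<partial>lborel) + (\<integral>\<^sup>+ x. ennreal (b x) \<partial>lborel)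
    \<le> 2 * (\<integral>\<^sup>+ x. ennreal (c * exp (- x\<^sup>2 / 2)) \<partial>lborel)"
proof -
  let ?w = "\<lambda>x. c * exp (- x\<^sup>2 / 2)"
  have w0: "0 \<le> ?w x" for x using c0 by simp
  have wm[measurable]: "?w \<in> borel_measurable borel" by measurable
  have key: "indicator {0<..} t * emeasure lborel {x. t < a x} + indicator {0<..} t * emeasure lborel {x. t < b x}
      \<le> 2 * (indicator {0<..} t * emeasure lborel {x. t < ?w x})" for t :: real
  proof (cases "0 < t \<and> t < 1")
    case True
    let ?A = "{x. t < a x}" and ?B = "{x. t < b x}"
    have mid: "t < ?w ((x + y) / 2)" if "x \<in> ?A" "y \<in> ?B" for x y
    proof -
      have "t\<^sup>2 < a x * b y" unfolding power2_eq_square using that True by (intro mult_strict_mono) auto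
      also have "\<dots> \<le> (?w ((x + y) / 2))\<^sup>2" by (rule ab)
      finally show ?thesis using w0 by (rule power2_less_imp_less)
    qed
    obtain x0 y0 where "x0 \<in> ?A" "y0 \<in> ?B" using asup bsup True by blast
    then have "t < ?w ((x0 + y0) / 2)" by (rule mid)
    also have "\<dots> \<le> c" using c0 by (simp add: mult_left_le)
    finally have tc: "t < c" .
    define r where "r = sqrt (2 * ln (c / t))"
    have r0: "0 \<le> r" unfolding r_def using tc True by simp
    have lev: "{x. t < ?w x} = {- r<..<r}"
      using gaussian_level_set[of t c] True tc by (simp add: r_def)
    have "\<bar>x + y\<bar> \<le> 2 * r" if "x \<in> ?A" "y \<in> ?B" for x y
    proof -
      have "(x + y) / 2 \<in> {x. t < ?w x}" using mid[OF that] by simp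
      then show ?thesis unfolding lev by auto
    qed
    then have "emeasure lborel ?A + emeasure lborel ?B \<le> ennreal (4 * r)"
      using \<open>x0 \<in> ?A\<close> \<open>y0 \<in> ?B\<close> by (intro add_emeasure_le_of_sums_bounded) blast+
    also have "\<dots> = 2 * ennreal (2 * r)"
      using ennreal_mult'[of 2 "2 * r"] by simp
    also have "ennreal (2 * r) = emeasure lborel {x. t < ?w x}"
      unfolding lev using r0 by simp
    finally show ?thesis using True by simp
  next
    case False
    then consider "t \<le> 0" | "1 \<le> t" by linarith
    then show ?thesis
    proof cases
      case 2
      then have "{x. t < a x} = {}" "{x. t < b x} = {}" using a1 b1 by (auto simp: not_less intro: order_trans)
      then show ?thesis by simp
    qed simp
  qed
  have "(\<integral>\<^sup>+ x. ennreal (a x) \<partial>lborel) + (\<integral>\<^sup>+ x. ennreal (b x) \<partial>lborel)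
     = (\<integral>\<^sup>+ t. indicator {0<..} t * emeasure lborel {x. t < a x} + indicator {0<..} t * emeasure lborel {x. t < b x} \<partial>lborel)"
    unfolding nn_integral_layer_cake[OF assms(1) a0] nn_integral_layer_cake[OF assms(2) b0]
    by (rule nn_integral_add[symmetric]) measurable
  also have "\<dots> \<le> (\<integral>\<^sup>+ t. 2 * (indicator {0<..} t * emeasure lborel {x. t < ?w x}) \<partial>lborel)"
    by (intro nn_integral_mono key)
  also have "\<dots> = 2 * (\<integral>\<^sup>+ t. indicator {0<..} t * emeasure lborel {x. t < ?w x} \<partial>lborel)"
    by (rule nn_integral_cmult) measurable
  also have "\<dots> = 2 * (\<integral>\<^sup>+ x. ennreal (?w x) \<partial>lborel)"
    unfolding nn_integral_layer_cake[OF wm w0] ..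
  finally show ?thesis .
qed

text \<open>
  Maurey's property \<open>(\<tau>)\<close> with cost \<open>(x - y)\<^sup>2 / 4\<close>, in multiplicative form. Absorbing the density
  into \<open>u\<close> and \<open>v\<close> completes the square in the exponent,
  \<open>(x - y)\<^sup>2 / 4 - x\<^sup>2 / 2 - y\<^sup>2 / 2 = - ((x + y) / 2)\<^sup>2\<close>, which is the Prekopa-Leindler hypothesis
  for the Gaussian density. The arithmetic mean that the level-set argument gives is then turned
  into a product by the inequality of the means, and the normalising constants cancel.
\<close>

lemma tau_std_normal:
  fixes u v :: "real \<Rightarrow> ennreal"
  assumes [measurable]: "u \<in> borel_measurable borel" "v \<in> borel_measurable borel"
    and uv: "\<And>x y. u x * v y \<le> ennreal (exp ((x - y)\<^sup>2 / 4))"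
  shows "(\<integral>\<^sup>+ x. u x \<partial>std_normal_distribution) * (\<integral>\<^sup>+ x. v x \<partial>std_normal_distribution) \<le> 1"
proof (cases "(\<forall>x. u x = 0) \<or> (\<forall>x. v x = 0)")
  case True
  then show ?thesis by auto
next
  case False
  then obtain x0 y0 where x0: "u x0 \<noteq> 0" and y0: "v y0 \<noteq> 0" by auto
  have ufin: "u x \<noteq> \<infinity>" for x
  proof
    assume "u x = \<infinity>"
    with uv[of x y0] y0 show False by (simp add: ennreal_top_mult top_unique)
  qed
  have vfin: "v y \<noteq> \<infinity>" for y
  proof
    assume "v y = \<infinity>"
    with uv[of x0 y] x0 show False by (simp add: ennreal_mult_top top_unique)
  qed
  define q where "q = (1 / sqrt (2 * pi))"
  define u1 where "u1 x = enn2real (u x) * (q * exp (- x\<^sup>2 / 2))" for x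
  define v1 where "v1 x = enn2real (v x) * (q * exp (- x\<^sup>2 / 2))" for x
  have q0: "0 < q" by (simp add: q_def)
  have sd: "std_normal_density x = q * exp (- x\<^sup>2 / 2)" for x by (simp add: std_normal_density_def q_def)
  have [measurable]: "u1 \<in> borel_measurable borel" "v1 \<in> borel_measurable borel"
    unfolding u1_def v1_def by measurable
  have u1_0: "0 \<le> u1 x" and v1_0: "0 \<le> v1 x" for x using q0 by (simp_all add: u1_def v1_def)
  have u1v1: "u1 x * v1 y \<le> (q * exp (- ((x + y) / 2)\<^sup>2 / 2))\<^sup>2" for x y
  proof -
    have "ennreal (enn2real (u x) * enn2real (v y)) = u x * v y"
      using ufin[of x] vfin[of y] by (simp add: ennreal_mult' ennreal_enn2real less_top)
    then have "enn2real (u x) * enn2real (v y) \<le> exp ((x - y)\<^sup>2 / 4)"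
      using uv[of x y] by (metis ennreal_le_iff exp_ge_zero)
    then have "(enn2real (u x) * enn2real (v y)) * ((q * exp (- x\<^sup>2 / 2)) * (q * exp (- y\<^sup>2 / 2)))
      \<le> exp ((x - y)\<^sup>2 / 4) * ((q * exp (- x\<^sup>2 / 2)) * (q * exp (- y\<^sup>2 / 2)))"
      using q0 by (intro mult_right_mono) auto
    then have "u1 x * v1 y \<le> exp ((x - y)\<^sup>2 / 4) * ((q * exp (- x\<^sup>2 / 2)) * (q * exp (- y\<^sup>2 / 2)))"
      by (simp only: u1_def v1_def mult.assoc mult.left_commute)
    also have "\<dots> = q\<^sup>2 * exp ((x - y)\<^sup>2 / 4 + (- x\<^sup>2 / 2) + (- y\<^sup>2 / 2))"
      unfolding exp_add by (simp only: power2_eq_square mult.assoc mult.left_commute)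
    also have "(x - y)\<^sup>2 / 4 + (- x\<^sup>2 / 2) + (- y\<^sup>2 / 2) = 2 * (- ((x + y) / 2)\<^sup>2 / 2)"
      by (simp add: power2_eq_square field_simps)
    also have "q\<^sup>2 * exp (2 * (- ((x + y) / 2)\<^sup>2 / 2)) = (q * exp (- ((x + y) / 2)\<^sup>2 / 2))\<^sup>2"
      by (simp add: power_mult_distrib flip: exp_double)
    finally show ?thesis .
  qed
  have Iu: "(\<integral>\<^sup>+ x. u x \<partial>std_normal_distribution) = (\<integral>\<^sup>+ x. ennreal (u1 x) \<partial>lborel)"
    using q0 ufin by (subst nn_integral_density, simp, simp, intro nn_integral_cong)
      (simp add: u1_def sd ennreal_mult' ennreal_enn2real less_top mult.commute)
  have Iv: "(\<integral>\<^sup>+ x. v x \<partial>std_normal_distribution) = (\<integral>\<^sup>+ x. ennreal (v1 x) \<partial>lborel)"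
    using q0 vfin by (subst nn_integral_density, simp, simp, intro nn_integral_cong)
      (simp add: v1_def sd ennreal_mult' ennreal_enn2real less_top mult.commute)
  have u1pos: "0 < u1 x0" using x0 ufin[of x0] q0 by (simp add: u1_def enn2real_positive_iff less_top zero_less_iff_neq_zero)
  have v1pos: "0 < v1 y0" using y0 vfin[of y0] q0 by (simp add: v1_def enn2real_positive_iff less_top zero_less_iff_neq_zero)
  have qle: "(q * exp (- m\<^sup>2 / 2))\<^sup>2 \<le> q\<^sup>2" for m
    using q0 by (intro power_mono) (auto simp: mult_left_le)
  \<comment> \<open>A point where \<open>v\<close> does not vanish bounds \<open>u\<close> from above, and conversely.\<close>
  have bu: "bdd_above (range u1)"
    by (rule bdd_aboveI[of _ "q\<^sup>2 / v1 y0"])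
      (use order_trans[OF u1v1 qle] v1pos in \<open>auto simp: field_simps\<close>)
  have bv: "bdd_above (range v1)"
    by (rule bdd_aboveI[of _ "q\<^sup>2 / u1 x0"])
      (use order_trans[OF u1v1 qle] u1pos in \<open>auto simp: field_simps\<close>)
  define U where "U = Sup (range u1)"
  define V where "V = Sup (range v1)"
  have uU: "u1 x \<le> U" and vV: "v1 x \<le> V" for x
    unfolding U_def V_def using bu bv by (auto intro: cSup_upper)
  have U0: "0 < U" and V0: "0 < V" using u1pos v1pos uU vV by (meson less_le_trans)+
  define c where "c = q / sqrt (U * V)"
  have c2: "c\<^sup>2 = q\<^sup>2 / (U * V)" using U0 V0 by (simp add: c_def power_divide)
  have main: "(\<integral>\<^sup>+ x. ennreal (u1 x / U) \<partial>lborel) + (\<integral>\<^sup>+ x. ennreal (v1 x / V) \<partial>lborel)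
    \<le> 2 * (\<integral>\<^sup>+ x. ennreal (c * exp (- x\<^sup>2 / 2)) \<partial>lborel)"
  proof (rule prekopa_leindler_gaussian_normalized)
    show "\<exists>x. t < u1 x / U" if "t < 1" for t
    proof -
      have "t * U < U" using that U0 by simp
      then obtain x where "t * U < u1 x"
        unfolding U_def using less_cSup_iff[of "range u1"] bu by auto
      then show ?thesis using U0 by (auto simp: field_simps)
    qed
    show "\<exists>x. t < v1 x / V" if "t < 1" for t
    proof -
      have "t * V < V" using that V0 by simp
      then obtain x where "t * V < v1 x"
        unfolding V_def using less_cSup_iff[of "range v1"] bv by auto
      then show ?thesis using V0 by (auto simp: field_simps)
    qed
    show "u1 x / U * (v1 y / V) \<le> (c * exp (- ((x + y) / 2)\<^sup>2 / 2))\<^sup>2" for x y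
      using u1v1[of x y] U0 V0 by (simp add: power_mult_distrib c2 divide_right_mono)
  qed (use u1_0 v1_0 uU vV U0 V0 q0 in \<open>auto simp: c_def\<close>)
  have "(\<integral>\<^sup>+ x. ennreal (c * exp (- x\<^sup>2 / 2)) \<partial>lborel) = (\<integral>\<^sup>+ x. ennreal (1 / sqrt (U * V)) * ennreal (std_normal_density x) \<partial>lborel)"
    using U0 V0 q0 by (intro nn_integral_cong) (simp add: sd c_def flip: ennreal_mult')
  also have "\<dots> = ennreal (1 / sqrt (U * V)) * (\<integral>\<^sup>+ x. ennreal (std_normal_density x) \<partial>lborel)"
    by (rule nn_integral_cmult) simp
  also have "(\<integral>\<^sup>+ x. ennreal (std_normal_density x) \<partial>lborel) = 1"
    using prob_space.emeasure_space_1[OF prob_space_normal_density[of 1 0]] by (simp add: emeasure_density)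
  finally have w: "(\<integral>\<^sup>+ x. ennreal (c * exp (- x\<^sup>2 / 2)) \<partial>lborel) = ennreal (1 / sqrt (U * V))" by simp
  let ?\<alpha> = "\<integral>\<^sup>+ x. ennreal (u1 x / U) \<partial>lborel" and ?\<beta> = "\<integral>\<^sup>+ x. ennreal (v1 x / V) \<partial>lborel"
  have le: "?\<alpha> + ?\<beta> \<le> ennreal (2 * (1 / sqrt (U * V)))"
    using main unfolding w by (subst ennreal_mult') auto
  then have "?\<alpha> \<noteq> top" "?\<beta> \<noteq> top" by (auto simp: top_unique)
  then obtain \<alpha> \<beta> where ab: "?\<alpha> = ennreal \<alpha>" "?\<beta> = ennreal \<beta>" "0 \<le> \<alpha>" "0 \<le> \<beta>"
    by (meson ennreal_cases)
  have "\<alpha> + \<beta> \<le> 2 * (1 / sqrt (U * V))"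
  proof -
    have "ennreal (\<alpha> + \<beta>) \<le> ennreal (2 * (1 / sqrt (U * V)))"
      using le ab by (simp add: ennreal_plus)
    then show ?thesis using U0 V0 by (subst (asm) ennreal_le_iff) auto
  qed
  then have "(\<alpha> + \<beta>)\<^sup>2 \<le> (2 * (1 / sqrt (U * V)))\<^sup>2" using ab by (intro power_mono) auto
  also have "\<dots> = 4 * (1 / (U * V))" using U0 V0 by (simp add: power_mult_distrib power_divide)
  finally have "\<alpha> * \<beta> \<le> 1 / (U * V)"
    using zero_le_power2[of "\<alpha> - \<beta>"] by (simp add: power2_eq_square algebra_simps)
  then have fin: "(U * \<alpha>) * (V * \<beta>) \<le> 1" using U0 V0 by (simp add: field_simps)
  have "(\<integral>\<^sup>+ x. ennreal (u1 x) \<partial>lborel) = ennreal U * ?\<alpha>"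
    using U0 by (subst nn_integral_cmult[symmetric]) (auto simp: u1_0 simp flip: ennreal_mult')
  moreover have "(\<integral>\<^sup>+ x. ennreal (v1 x) \<partial>lborel) = ennreal V * ?\<beta>"
    using V0 by (subst nn_integral_cmult[symmetric]) (auto simp: v1_0 simp flip: ennreal_mult')
  ultimately show ?thesis
    unfolding Iu Iv ab using fin U0 V0 ab(3,4) by (simp flip: ennreal_mult')
qed

section \<open>Gaussian product measures\<close>

abbreviation gaussian_on :: "'i set \<Rightarrow> ('i \<Rightarrow> real) measure" where
  "gaussian_on I \<equiv> Pi\<^sub>M I (\<lambda>_. std_normal_distribution)"

lemma prob_space_std_normal: "prob_space std_normal_distribution"
  by (rule prob_space_normal_density) simp

lemma product_prob_space_std_normal: "product_prob_space (\<lambda>_. std_normal_distribution)"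
  by (intro product_prob_spaceI prob_space_std_normal)

lemma prob_space_gaussian_on: "prob_space (gaussian_on I)"
  by (intro prob_space_PiM prob_space_std_normal)

text \<open>
  The property tensorises: for fixed values \<open>s\<close> and \<open>t\<close> of the new coordinate, the induction
  hypothesis applied to \<open>u\<close> and to \<open>v\<close> times \<open>exp (- (s - t)\<^sup>2 / 4)\<close> says exactly that the partial
  integrals satisfy the hypothesis of the one-dimensional case.
\<close>

lemma tau_gaussian_on:
  fixes u v :: "('i \<Rightarrow> real) \<Rightarrow> ennreal"
  assumes "finite I"
    and "u \<in> borel_measurable (gaussian_on I)" "v \<in> borel_measurable (gaussian_on I)"
    and "\<And>x y. x \<in> space (gaussian_on I) \<Longrightarrow> y \<in> space (gaussian_on I) \<Longrightarrow>
          u x * v y \<le> ennreal (exp ((\<Sum>i\<in>I. (x i - y i)\<^sup>2) / 4))"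
  shows "(\<integral>\<^sup>+ x. u x \<partial>gaussian_on I) * (\<integral>\<^sup>+ x. v x \<partial>gaussian_on I) \<le> 1"
  using assms
proof (induction I arbitrary: u v rule: finite_induct)
  case empty
  interpret product_prob_space "\<lambda>_::'i. std_normal_distribution" UNIV by (rule product_prob_space_std_normal)
  show ?case using empty(3)[of "\<lambda>_. undefined" "\<lambda>_. undefined"]
    by (simp add: nn_integral_empty space_PiM)
next
  case (insert i I)
  interpret product_prob_space "\<lambda>_::'i. std_normal_distribution" UNIV by (rule product_prob_space_std_normal)
  note [measurable] = insert.prems(1,2)
  let ?U = "\<lambda>s. \<integral>\<^sup>+ x. u (x(i := s)) \<partial>gaussian_on I" and ?V = "\<lambda>s. \<integral>\<^sup>+ x. v (x(i := s)) \<partial>gaussian_on I"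
  interpret G: prob_space "gaussian_on I" by (rule prob_space_gaussian_on)
  have [measurable]: "?U \<in> borel_measurable std_normal_distribution" "?V \<in> borel_measurable std_normal_distribution"
    by measurable
  have UV: "?U s * ?V t \<le> ennreal (exp ((s - t)\<^sup>2 / 4))" for s t
  proof -
    have [measurable]: "(\<lambda>x. u (x(i := s))) \<in> borel_measurable (gaussian_on I)"
       "(\<lambda>x. v (x(i := t))) \<in> borel_measurable (gaussian_on I)" by measurable
    define e where "e = exp (- ((s - t)\<^sup>2 / 4))"
    have e0: "0 \<le> e" by (simp add: e_def)
    have "(\<integral>\<^sup>+ x. u (x(i := s)) \<partial>gaussian_on I) * (\<integral>\<^sup>+ x. ennreal e * v (x(i := t)) \<partial>gaussian_on I) \<le> 1"
    proof (rule insert.IH)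
      fix x y assume "x \<in> space (gaussian_on I)" "y \<in> space (gaussian_on I)"
      then have *: "x(i := s) \<in> space (gaussian_on (insert i I))" "y(i := t) \<in> space (gaussian_on (insert i I))"
        by (simp_all add: space_PiM PiE_fun_upd)
      have "(\<Sum>j\<in>insert i I. ((x(i := s)) j - (y(i := t)) j)\<^sup>2) = (s - t)\<^sup>2 + (\<Sum>j\<in>I. (x j - y j)\<^sup>2)"
        using insert.hyps by (simp, intro sum.cong) auto
      then have "u (x(i := s)) * v (y(i := t)) \<le> ennreal (exp ((s - t)\<^sup>2 / 4 + (\<Sum>j\<in>I. (x j - y j)\<^sup>2) / 4))"
        using insert.prems(3)[OF *] by (simp only: add_divide_distrib)
      then have "ennreal e * (u (x(i := s)) * v (y(i := t)))
        \<le> ennreal e * ennreal (exp ((s - t)\<^sup>2 / 4 + (\<Sum>j\<in>I. (x j - y j)\<^sup>2) / 4))"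
        by (intro mult_left_mono) auto
      also have "\<dots> = ennreal (exp ((\<Sum>j\<in>I. (x j - y j)\<^sup>2) / 4))"
        by (simp add: e_def flip: ennreal_mult' exp_add)
      finally show "u (x(i := s)) * (ennreal e * v (y(i := t))) \<le> ennreal (exp ((\<Sum>j\<in>I. (x j - y j)\<^sup>2) / 4))"
        by (simp only: mult.left_commute)
    qed measurable
    then have "ennreal e * (?U s * ?V t) \<le> 1"
      by (subst (asm) nn_integral_cmult) (simp_all add: mult.left_commute)
    then have "ennreal (exp ((s - t)\<^sup>2 / 4)) * (ennreal e * (?U s * ?V t)) \<le> ennreal (exp ((s - t)\<^sup>2 / 4)) * 1"
      by (intro mult_left_mono) auto
    then show ?thesis
      by (simp add: e_def flip: mult.assoc ennreal_mult' exp_add)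
  qed
  have "(\<integral>\<^sup>+ s. ?U s \<partial>std_normal_distribution) * (\<integral>\<^sup>+ s. ?V s \<partial>std_normal_distribution) \<le> 1"
    by (rule tau_std_normal[OF _ _ UV]) simp_all
  then show ?case
    using insert.hyps by (simp add: product_nn_integral_insert_rev)
qed

lemma nn_integral_std_normal_shift:
  assumes [measurable]: "f \<in> borel_measurable borel"
  shows "(\<integral>\<^sup>+ x. f x \<partial>std_normal_distribution)
    = (\<integral>\<^sup>+ x. f (x + h) * ennreal (exp (- (h * x) - h\<^sup>2 / 2)) \<partial>std_normal_distribution)"
proof -
  have "(\<integral>\<^sup>+ x. f x \<partial>std_normal_distribution) = (\<integral>\<^sup>+ x. ennreal (std_normal_density x) * f x \<partial>lborel)"
    by (rule nn_integral_density) simp_all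
  also have "\<dots> = (\<integral>\<^sup>+ x. ennreal (std_normal_density (h + x)) * f (h + x) \<partial>lborel)"
    using nn_integral_real_affine[of "\<lambda>x. ennreal (std_normal_density x) * f x" 1 h] by simp
  also have "\<dots> = (\<integral>\<^sup>+ x. ennreal (std_normal_density x) * (f (x + h) * ennreal (exp (- (h * x) - h\<^sup>2 / 2))) \<partial>lborel)"
  proof (rule nn_integral_cong)
    fix x :: real
    have "- (h + x)\<^sup>2 / 2 = - x\<^sup>2 / 2 + (- (h * x) - h\<^sup>2 / 2)"
      by (simp add: power2_eq_square field_simps)
    then have "std_normal_density (h + x) = std_normal_density x * exp (- (h * x) - h\<^sup>2 / 2)"
      unfolding std_normal_density_def by (simp only: exp_add mult.assoc)
    then show "ennreal (std_normal_density (h + x)) * f (h + x)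
      = ennreal (std_normal_density x) * (f (x + h) * ennreal (exp (- (h * x) - h\<^sup>2 / 2)))"
      by (simp add: ennreal_mult' mult.assoc mult.left_commute mult.commute add.commute)
  qed
  also have "\<dots> = (\<integral>\<^sup>+ x. f (x + h) * ennreal (exp (- (h * x) - h\<^sup>2 / 2)) \<partial>std_normal_distribution)"
    by (rule nn_integral_density[symmetric]) simp_all
  finally show ?thesis .
qed

text \<open>The Cameron-Martin formula, one coordinate at a time.\<close>

lemma nn_integral_gaussian_on_shift:
  fixes f :: "('i \<Rightarrow> real) \<Rightarrow> ennreal"
  assumes "finite I" "f \<in> borel_measurable (gaussian_on I)"
  shows "(\<integral>\<^sup>+ x. f x \<partial>gaussian_on I)
    = (\<integral>\<^sup>+ x. f (\<lambda>i\<in>I. x i + h i) * ennreal (exp (- (\<Sum>i\<in>I. h i * x i) - (\<Sum>i\<in>I. (h i)\<^sup>2) / 2)) \<partial>gaussian_on I)"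
  using assms
proof (induction I arbitrary: f rule: finite_induct)
  case empty
  interpret product_prob_space "\<lambda>_::'i. std_normal_distribution" UNIV by (rule product_prob_space_std_normal)
  show ?case
    using prob_space.emeasure_space_1[OF prob_space_gaussian_on[of "{} :: 'i set"]]
    by (simp add: nn_integral_empty restrict_def)
next
  case (insert i I)
  interpret product_prob_space "\<lambda>_::'i. std_normal_distribution" UNIV by (rule product_prob_space_std_normal)
  interpret G: prob_space "gaussian_on I" by (rule prob_space_gaussian_on)
  note [measurable] = insert.prems
  let ?w = "\<lambda>J x. ennreal (exp (- (\<Sum>i\<in>J. h i * x i) - (\<Sum>i\<in>J. (h i)\<^sup>2) / 2))"
  let ?w1 = "\<lambda>s. ennreal (exp (- (h i * s) - (h i)\<^sup>2 / 2))"
  have [measurable]: "(\<lambda>x. \<lambda>j\<in>J. x j + h j) \<in> gaussian_on J \<rightarrow>\<^sub>M gaussian_on J" for J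
    by (rule measurable_restrict) simp
  have [measurable]: "?w J \<in> borel_measurable (gaussian_on J)" for J by measurable
  have shift: "(\<lambda>j\<in>insert i I. (x(i := s)) j + h j) = (\<lambda>j\<in>I. x j + h j)(i := s + h i)" for x s
    using insert.hyps by (auto simp: fun_eq_iff)
  have wsplit: "?w (insert i I) (x(i := s)) = ?w1 s * ?w I x" for x s
  proof -
    have "(\<Sum>j\<in>insert i I. h j * (x(i := s)) j) = h i * s + (\<Sum>j\<in>I. h j * x j)"
      using insert.hyps by (simp, intro sum.cong) auto
    then show ?thesis using insert.hyps
      by (simp add: add_divide_distrib algebra_simps flip: ennreal_mult' exp_add)
  qed
  have "(\<integral>\<^sup>+ x. f x \<partial>gaussian_on (insert i I)) = (\<integral>\<^sup>+ s. (\<integral>\<^sup>+ x. f (x(i := s)) \<partial>gaussian_on I) \<partial>std_normal_distribution)"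
    using insert.hyps by (simp add: product_nn_integral_insert_rev)
  also have "\<dots> = (\<integral>\<^sup>+ s. (\<integral>\<^sup>+ x. f (x(i := s + h i)) \<partial>gaussian_on I) * ?w1 s \<partial>std_normal_distribution)"
    by (rule nn_integral_std_normal_shift) (simp cong: measurable_cong_sets, measurable)
  also have "\<dots> = (\<integral>\<^sup>+ s. (\<integral>\<^sup>+ x. f ((\<lambda>j\<in>I. x j + h j)(i := s + h i)) * ?w I x \<partial>gaussian_on I) * ?w1 s \<partial>std_normal_distribution)"
  proof (rule nn_integral_cong)
    fix s :: real
    have [measurable]: "(\<lambda>x. f (x(i := s + h i))) \<in> borel_measurable (gaussian_on I)" by measurable
    show "(\<integral>\<^sup>+ x. f (x(i := s + h i)) \<partial>gaussian_on I) * ?w1 s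
      = (\<integral>\<^sup>+ x. f ((\<lambda>j\<in>I. x j + h j)(i := s + h i)) * ?w I x \<partial>gaussian_on I) * ?w1 s"
      by (subst insert.IH[of "\<lambda>x. f (x(i := s + h i))"]) simp_all
  qed
  also have "\<dots> = (\<integral>\<^sup>+ s. (\<integral>\<^sup>+ x. f (\<lambda>j\<in>insert i I. (x(i := s)) j + h j) * ?w (insert i I) (x(i := s)) \<partial>gaussian_on I) \<partial>std_normal_distribution)"
    unfolding shift wsplit
    by (intro nn_integral_cong, subst nn_integral_multc[symmetric]) (simp_all add: mult.assoc mult.commute mult.left_commute)
  also have "\<dots> = (\<integral>\<^sup>+ x. f (\<lambda>j\<in>insert i I. x j + h j) * ?w (insert i I) x \<partial>gaussian_on (insert i I))"
    using insert.hyps by (subst product_nn_integral_insert_rev) simp_all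
  finally show ?case .
qed

lemma
  assumes "i \<in> I"
  shows integrable_gaussian_on_coord: "integrable (gaussian_on I) (\<lambda>z. z i)"
    and integrable_gaussian_on_coord_square: "integrable (gaussian_on I) (\<lambda>z. (z i)\<^sup>2)"
    and integral_gaussian_on_coord: "(LINT z|gaussian_on I. z i) = 0"
proof -
  have d: "distr (gaussian_on I) std_normal_distribution (\<lambda>z. z i) = std_normal_distribution"
    using assms by (intro distr_PiM_component prob_space_std_normal)
  have [measurable]: "(\<lambda>z. z i) \<in> gaussian_on I \<rightarrow>\<^sub>M std_normal_distribution"
    using assms by (rule measurable_component_singleton)
  then have [measurable]: "(\<lambda>z. z i) \<in> borel_measurable (gaussian_on I)"
    by (simp cong: measurable_cong_sets)
  have *: "integrable (gaussian_on I) (\<lambda>z. (z i) ^ k)" for k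
  proof -
    have "integrable (distr (gaussian_on I) std_normal_distribution (\<lambda>z. z i)) (\<lambda>x. x ^ k)"
      unfolding d by (rule integrable_std_normal_distribution_moment)
    then show ?thesis by (subst (asm) integrable_distr_eq) simp_all
  qed
  show "integrable (gaussian_on I) (\<lambda>z. z i)" "integrable (gaussian_on I) (\<lambda>z. (z i)\<^sup>2)"
    using *[of 1] *[of 2] by simp_all
  have "(LINT x|distr (gaussian_on I) std_normal_distribution (\<lambda>z. z i). x ^ 1) = 0"
    unfolding d by (rule integral_std_normal_distribution_moment_odd) simp
  then show "(LINT z|gaussian_on I. z i) = 0"
    by (subst (asm) integral_distr) simp_all
qed

section \<open>Projection onto a closed convex set\<close>

definition sqdist :: "nat \<Rightarrow> (nat \<Rightarrow> real) \<Rightarrow> (nat \<Rightarrow> real) \<Rightarrow> real" where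
  "sqdist n x y = (\<Sum>i<n. (x i - y i)\<^sup>2)"

lemma enorm_vminus_square: "(enorm n (vminus n x y))\<^sup>2 = sqdist n x y"
  by (simp add: enorm_def vminus_def L2_set_def sqdist_def sum_nonneg)

lemma sqdist_nonneg [simp]: "0 \<le> sqdist n x y"
  by (simp add: sqdist_def sum_nonneg)

lemma enorm_le_iff_sqdist_le:
  "enorm n (vminus n x p) \<le> enorm n (vminus n x y) \<longleftrightarrow> sqdist n x p \<le> sqdist n x y"
  by (simp add: enorm_def vminus_def L2_set_def sqdist_def)

lemma sqdist_commute: "sqdist n x y = sqdist n y x"
  by (simp add: sqdist_def power2_commute)

lemma sqdist_eq_0_imp_eq:
  assumes "x \<in> rspace n" "y \<in> rspace n" "sqdist n x y = 0"
  shows "x = y"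
proof
  fix i show "x i = y i"
    using assms by (cases "i < n") (auto simp: sqdist_def rspace_def sum_nonneg_eq_0_iff PiE_iff extensional_def)
qed

lemma sqdist_triangle_double: "sqdist n x z \<le> 2 * sqdist n x y + 2 * sqdist n y z"
proof -
  have "(x i - z i)\<^sup>2 \<le> 2 * (x i - y i)\<^sup>2 + 2 * (y i - z i)\<^sup>2" for i
    using zero_le_power2[of "(x i - y i) - (y i - z i)"] by (simp add: power2_eq_square algebra_simps)
  then have "(\<Sum>i<n. (x i - z i)\<^sup>2) \<le> (\<Sum>i<n. 2 * (x i - y i)\<^sup>2 + 2 * (y i - z i)\<^sup>2)"
    by (intro sum_mono)
  then show ?thesis by (simp add: sqdist_def sum.distrib sum_distrib_left)
qed

lemma continuous_map_sqdist: "continuous_map (rtop n) euclideanreal (\<lambda>y. sqdist n x y)"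
  unfolding sqdist_def rtop_def
  by (intro continuous_map_sum continuous_map_real_pow continuous_map_diff continuous_map_canonical_const
      continuous_map_product_projection) auto

locale closed_convex =
  fixes n :: nat and K :: "(nat \<Rightarrow> real) set"
  assumes sub: "K \<subseteq> rspace n" and nonempty: "K \<noteq> {}"
    and closed: "closedin (rtop n) K" and conv: "rconvex n K"
begin

text \<open>
  Only the points of \<open>K\<close> in a box around \<open>x\<close> matter, and these form a compact set.
\<close>

lemma ex_nearest: "\<exists>p\<in>K. \<forall>y\<in>K. sqdist n x p \<le> sqdist n x y"
proof -
  obtain k where k: "k \<in> K" using nonempty by blast
  define r where "r = sqrt (sqdist n x k)"
  define Box where "Box = Pi\<^sub>E {..<n} (\<lambda>i. {x i - r..x i + r})"
  have near: "y \<in> Box" if "y \<in> K" "sqdist n x y \<le> sqdist n x k" for y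
  proof -
    have "\<bar>x i - y i\<bar> \<le> r" if "i < n" for i
    proof -
      have "(x i - y i)\<^sup>2 \<le> sqdist n x y"
        unfolding sqdist_def using that by (intro member_le_sum[where f="\<lambda>i. (x i - y i)\<^sup>2"]) auto
      also have "\<dots> \<le> sqdist n x k" by fact
      finally show ?thesis unfolding r_def by (rule real_le_rsqrt[of "\<bar>x i - y i\<bar>", simplified])
    qed
    then have "x i - r \<le> y i" "y i \<le> x i + r" if "i < n" for i using that by (fastforce simp: abs_le_iff)+
    then show ?thesis using \<open>y \<in> K\<close> sub by (auto simp: Box_def rspace_def PiE_iff)
  qed
  have "compactin (rtop n) Box"
    unfolding rtop_def Box_def by (subst compactin_PiE) (auto simp: compactin_euclidean_iff)
  then have cpt: "compactin (rtop n) (Box \<inter> K)"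
    using closed by (metis closed_Int_compactin inf_commute)
  then have "compactin euclideanreal ((\<lambda>y. sqdist n x y) ` (Box \<inter> K))"
    using continuous_map_sqdist by (rule image_compactin)
  then have "compact ((\<lambda>y. sqdist n x y) ` (Box \<inter> K))" by (simp add: compactin_euclidean_iff)
  moreover have kB: "k \<in> Box \<inter> K" using near[of k] k by simp
  ultimately obtain p where p: "p \<in> Box \<inter> K" "\<And>y. y \<in> Box \<inter> K \<Longrightarrow> sqdist n x p \<le> sqdist n x y"
    using compact_attains_inf[of "(\<lambda>y. sqdist n x y) ` (Box \<inter> K)"] by blast
  have "sqdist n x p \<le> sqdist n x y" if "y \<in> K" for y
    using p(2)[of y] p(2)[OF kB] near[OF that] that by (cases "sqdist n x y \<le> sqdist n x k") auto
  then show ?thesis using p(1) by blast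
qed

text \<open>
  Otherwise moving from \<open>p\<close> towards \<open>y\<close> by a small step \<open>t\<close> would decrease the distance to \<open>x\<close> to
  first order; \<open>t = a / (a + b)\<close> is small enough for the second-order term \<open>t\<^sup>2 * b\<close> not to
  interfere.
\<close>

lemma nearest_variational:
  assumes p: "p \<in> K" "\<And>y. y \<in> K \<Longrightarrow> sqdist n x p \<le> sqdist n x y" and y: "y \<in> K"
  shows "(\<Sum>i<n. (x i - p i) * (y i - p i)) \<le> 0"
proof (rule ccontr)
  define a where "a = (\<Sum>i<n. (x i - p i) * (y i - p i))"
  define b where "b = sqdist n y p"
  assume "\<not> ?thesis"
  then have a0: "0 < a" by (simp add: a_def)
  have b0: "0 \<le> b" by (simp add: b_def)
  define t where "t = a / (a + b)"
  have t: "0 < t" "t \<le> 1" using a0 b0 by (auto simp: t_def)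
  define q where "q = vadd n (vscale n (1 - t) p) (vscale n t y)"
  have "q \<in> K" using conv p(1) y t unfolding rconvex_def q_def by auto
  then have "sqdist n x p \<le> sqdist n x q" by (rule p(2))
  also have "sqdist n x q = (\<Sum>i<n. (x i - p i)\<^sup>2 - 2 * t * ((x i - p i) * (y i - p i)) + t\<^sup>2 * (y i - p i)\<^sup>2)"
    unfolding sqdist_def by (intro sum.cong) (auto simp: q_def vadd_def vscale_def power2_eq_square algebra_simps)
  also have "\<dots> = sqdist n x p - 2 * t * a + t\<^sup>2 * b"
    by (simp add: sqdist_def a_def b_def sum.distrib sum_subtractf sum_distrib_left)
  finally have "2 * t * a \<le> t\<^sup>2 * b" by simp
  then have "2 * a \<le> t * b" using t by (simp add: power2_eq_square)
  also have "t * b \<le> a" using a0 b0 by (simp add: t_def field_simps)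
  finally show False using a0 by simp
qed

lemma proj_nearest: "proj n K x \<in> K \<and> (\<forall>y\<in>K. sqdist n x (proj n K x) \<le> sqdist n x y)"
proof -
  obtain p where p: "p \<in> K" "\<And>y. y \<in> K \<Longrightarrow> sqdist n x p \<le> sqdist n x y" using ex_nearest by blast
  have uniq: "q = p" if q: "q \<in> K" "\<And>y. y \<in> K \<Longrightarrow> sqdist n x q \<le> sqdist n x y" for q
  proof -
    have "sqdist n q p = (\<Sum>i<n. (x i - p i) * (q i - p i)) + (\<Sum>i<n. (x i - q i) * (p i - q i))"
      unfolding sqdist_def sum.distrib[symmetric] by (intro sum.cong) (auto simp: power2_eq_square algebra_simps)
    also have "\<dots> \<le> 0" using nearest_variational[OF p q(1)] nearest_variational[OF q p(1)] by simp
    finally have "sqdist n q p = 0" using sqdist_nonneg[of n q p] by simp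
    with p(1) q(1) sub show ?thesis by (intro sqdist_eq_0_imp_eq) auto
  qed
  have "proj n K x = p"
    unfolding proj_def enorm_le_iff_sqdist_le
  proof (rule the_equality)
    show "p \<in> K \<and> (\<forall>y\<in>K. sqdist n x p \<le> sqdist n x y)" using p by blast
    show "q = p" if "q \<in> K \<and> (\<forall>y\<in>K. sqdist n x q \<le> sqdist n x y)" for q
      using uniq that by blast
  qed
  then show ?thesis using p by blast
qed

lemma proj_in: "proj n K x \<in> K" using proj_nearest by blast

lemma proj_le: "y \<in> K \<Longrightarrow> sqdist n x (proj n K x) \<le> sqdist n x y" using proj_nearest by blast

lemma proj_variational: "y \<in> K \<Longrightarrow> (\<Sum>i<n. (x i - proj n K x i) * (y i - proj n K x i)) \<le> 0"
  using nearest_variational[of "proj n K x" x y] proj_nearest by blast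

lemma proj_nonexpansive: "sqdist n (proj n K x) (proj n K y) \<le> sqdist n x y"
proof -
  let ?p = "proj n K x" and ?q = "proj n K y"
  have "0 \<le> (\<Sum>i<n. ((x i - y i) - (?p i - ?q i))\<^sup>2)" by (simp add: sum_nonneg)
  also have "\<dots> = sqdist n x y - sqdist n ?p ?q
      + 2 * ((\<Sum>i<n. (x i - ?p i) * (?q i - ?p i)) + (\<Sum>i<n. (y i - ?q i) * (?p i - ?q i)))"
    unfolding sqdist_def sum_distrib_left sum.distrib[symmetric] sum_subtractf[symmetric]
    by (intro sum.cong) (auto simp: power2_eq_square algebra_simps)
  also have "\<dots> \<le> sqdist n x y - sqdist n ?p ?q"
    using proj_variational[OF proj_in, of x y] proj_variational[OF proj_in, of y x] by simp
  finally show ?thesis by simp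
qed

lemma continuous_map_proj_coord:
  assumes "i < n"
  shows "continuous_map (rtop n) euclideanreal (\<lambda>x. proj n K x i)"
  unfolding continuous_map
proof (intro conjI allI impI)
  fix V :: "real set" assume "openin euclideanreal V"
  then have V: "open V" by simp
  let ?U = "{x \<in> topspace (rtop n). proj n K x i \<in> V}"
  show "openin (rtop n) ?U"
  proof (subst openin_subopen, intro ballI)
    fix x assume x: "x \<in> ?U"
    then obtain e where e: "0 < e" "\<And>t. \<bar>t - proj n K x i\<bar> < e \<Longrightarrow> t \<in> V"
      using V unfolding open_dist dist_real_def by blast
    let ?T = "{y \<in> topspace (rtop n). sqdist n x y \<in> {..<e\<^sup>2}}"
    have "openin (rtop n) ?T"
      using continuous_map_sqdist by (rule openin_continuous_map_preimage) simp
    moreover have "x \<in> ?T" using x e(1) by (simp add: sqdist_def)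
    moreover have "?T \<subseteq> ?U"
    proof safe
      fix y assume "sqdist n x y < e\<^sup>2"
      moreover have "(proj n K y i - proj n K x i)\<^sup>2 \<le> sqdist n (proj n K y) (proj n K x)"
        unfolding sqdist_def using assms
        by (intro member_le_sum[where f="\<lambda>i. (proj n K y i - proj n K x i)\<^sup>2"]) auto
      ultimately have "\<bar>proj n K y i - proj n K x i\<bar>\<^sup>2 < e\<^sup>2"
        using proj_nonexpansive[of y x] by (simp add: sqdist_commute)
      then have "\<bar>proj n K y i - proj n K x i\<bar> < e" using e(1) by (simp add: power2_less_imp_less)
      then show "proj n K y i \<in> V" by (rule e(2))
    qed
    ultimately show "\<exists>T. openin (rtop n) T \<and> x \<in> T \<and> T \<subseteq> ?U" by blast
  qed
qed simp

lemma measurable_proj [measurable]: "proj n K \<in> rborel n \<rightarrow>\<^sub>M rborel n"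
  unfolding rborel_def
proof (rule measurable_PiM_single')
  show "(\<lambda>x. proj n K x i) \<in> borel_measurable (Pi\<^sub>M {..<n} (\<lambda>_. borel))" if "i \<in> {..<n}" for i
  proof (rule borel_measurableI)
    fix V :: "real set" assume "open V"
    then have "openin (rtop n) {x \<in> topspace (rtop n). proj n K x i \<in> V}"
      using continuous_map_proj_coord that by (intro openin_continuous_map_preimage) auto
    then have "{x \<in> topspace (rtop n). proj n K x i \<in> V} \<in> sets (rborel n)"
      unfolding sets_rborel by auto
    moreover have "{x \<in> topspace (rtop n). proj n K x i \<in> V} = (\<lambda>x. proj n K x i) -` V \<inter> space (rborel n)"
      by (auto simp: topspace_rtop space_rborel)
    ultimately show "(\<lambda>x. proj n K x i) -` V \<inter> space (Pi\<^sub>M {..<n} (\<lambda>_. borel)) \<in> sets (Pi\<^sub>M {..<n} (\<lambda>_. borel))"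
      by (simp add: rborel_def)
  qed
  show "proj n K \<in> space (Pi\<^sub>M {..<n} (\<lambda>_. borel)) \<rightarrow> ({..<n} \<rightarrow>\<^sub>E space borel)"
    using proj_in sub by (auto simp: rspace_def)
qed

end

section \<open>The standard Gaussian vector\<close>

text \<open>
  Jensen's inequality with an integral on the right that may be infinite. It follows from the
  tangent of \<open>exp\<close> at the mean.
\<close>

lemma exp_integral_le_nn_integral_exp:
  fixes X :: "'a \<Rightarrow> real"
  assumes "prob_space M" and X: "integrable M X"
  shows "ennreal (exp (LINT x|M. X x)) \<le> (\<integral>\<^sup>+ x. ennreal (exp (X x)) \<partial>M)"
proof (cases "(\<integral>\<^sup>+ x. ennreal (exp (X x)) \<partial>M) = \<infinity>")
  case False
  interpret prob_space M by fact
  note [measurable] = borel_measurable_integrable[OF X]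
  have int: "integrable M (\<lambda>x. exp (X x))"
    using False by (intro integrableI_nonneg) (auto simp: less_top)
  define c where "c = (LINT x|M. X x)"
  have "(LINT x|M. exp c * (1 + (X x - c))) \<le> (LINT x|M. exp (X x))"
  proof (rule integral_mono)
    show "exp c * (1 + (X x - c)) \<le> exp (X x)" for x
      using exp_ge_add_one_self[of "X x - c"] mult_left_mono[of "1 + (X x - c)" "exp (X x - c)" "exp c"]
      by (simp add: exp_diff)
  qed (use X int in auto)
  also have "(LINT x|M. exp c * (1 + (X x - c))) = exp c"
    using X by (simp add: c_def prob_space)
  finally have "ennreal (exp c) \<le> ennreal (LINT x|M. exp (X x))" by (rule ennreal_leI)
  also have "\<dots> = (\<integral>\<^sup>+ x. ennreal (exp (X x)) \<partial>M)"
    using int by (intro nn_integral_eq_integral[symmetric]) auto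
  finally show ?thesis by (simp add: c_def)
qed simp

lemma prob_space_std_gaussian: "prob_space (std_gaussian n)"
  unfolding std_gaussian_def by (rule prob_space_gaussian_on)

lemma sets_std_gaussian [measurable_cong]: "sets (std_gaussian n) = sets (rborel n)"
  unfolding std_gaussian_def rborel_def by (intro sets_PiM_cong) simp_all

lemma measurable_rborel_coord [measurable]: "i < n \<Longrightarrow> (\<lambda>x. x i) \<in> borel_measurable (rborel n)"
  unfolding rborel_def by (rule measurable_component_singleton) simp

lemma measurable_rborelI:
  "(\<And>i. i < n \<Longrightarrow> (\<lambda>x. f x i) \<in> borel_measurable M) \<Longrightarrow> (\<lambda>x. \<lambda>i\<in>{..<n}. f x i) \<in> M \<rightarrow>\<^sub>M rborel n"
  unfolding rborel_def by (rule measurable_restrict) simp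

lemma measurable_sqdist [measurable]:
  assumes [measurable]: "f \<in> M \<rightarrow>\<^sub>M rborel n" "g \<in> M \<rightarrow>\<^sub>M rborel n"
  shows "(\<lambda>x. sqdist n (f x) (g x)) \<in> borel_measurable M"
proof -
  have [measurable]: "(\<lambda>x. f x i) \<in> borel_measurable M" "(\<lambda>x. g x i) \<in> borel_measurable M" if "i < n" for i
    using that by measurable
  show ?thesis unfolding sqdist_def by measurable
qed

definition inner_prod :: "nat \<Rightarrow> (nat \<Rightarrow> real) \<Rightarrow> (nat \<Rightarrow> real) \<Rightarrow> real" where
  "inner_prod n x y = (\<Sum>i<n. x i * y i)"

lemma measurable_inner_prod [measurable]:
  assumes [measurable]: "\<And>i. i < n \<Longrightarrow> (\<lambda>x. f x i) \<in> borel_measurable M" "\<And>i. i < n \<Longrightarrow> (\<lambda>x. g x i) \<in> borel_measurable M"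
  shows "(\<lambda>x. inner_prod n (f x) (g x)) \<in> borel_measurable M"
  unfolding inner_prod_def by measurable

lemma inner_prod_le:
  assumes "0 < t"
  shows "\<bar>inner_prod n z (\<lambda>i. x i - y i)\<bar> \<le> t * (\<Sum>i<n. (z i)\<^sup>2) / 2 + sqdist n x y / (2 * t)"
proof -
  have "\<bar>z i * (x i - y i)\<bar> \<le> t * (z i)\<^sup>2 / 2 + (x i - y i)\<^sup>2 / (2 * t)" for i
  proof -
    have "0 \<le> (t * \<bar>z i\<bar> - \<bar>x i - y i\<bar>)\<^sup>2" by simp
    also have "\<dots> = t\<^sup>2 * (z i)\<^sup>2 - 2 * t * \<bar>z i * (x i - y i)\<bar> + (x i - y i)\<^sup>2"
      by (subst power2_diff) (simp add: power_mult_distrib abs_mult)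
    finally show ?thesis using assms by (simp add: field_simps power2_eq_square)
  qed
  then have "(\<Sum>i<n. \<bar>z i * (x i - y i)\<bar>) \<le> (\<Sum>i<n. t * (z i)\<^sup>2 / 2 + (x i - y i)\<^sup>2 / (2 * t))"
    by (intro sum_mono)
  also have "\<dots> = t * (\<Sum>i<n. (z i)\<^sup>2) / 2 + sqdist n x y / (2 * t)"
    by (simp add: sqdist_def sum.distrib sum_divide_distrib sum_distrib_left)
  finally show ?thesis unfolding inner_prod_def by (rule order_trans[OF sum_abs])
qed

lemma integrable_std_gaussian_square: "integrable (std_gaussian n) (\<lambda>z. \<Sum>i<n. (z i)\<^sup>2)"
  unfolding std_gaussian_def by (intro Bochner_Integration.integrable_sum integrable_gaussian_on_coord_square) auto

lemma
  shows integrable_std_gaussian_inner_prod: "integrable (std_gaussian n) (\<lambda>z. inner_prod n z a)"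
    and integral_std_gaussian_inner_prod: "(LINT z|std_gaussian n. inner_prod n z a) = 0"
proof -
  have *: "integrable (std_gaussian n) (\<lambda>z. z i * a i)" "(LINT z|std_gaussian n. z i * a i) = 0" if "i \<in> {..<n}" for i
    using that unfolding std_gaussian_def
    by (simp_all add: integrable_gaussian_on_coord integral_gaussian_on_coord)
  show "integrable (std_gaussian n) (\<lambda>z. inner_prod n z a)"
    unfolding inner_prod_def by (intro Bochner_Integration.integrable_sum *)
  show "(LINT z|std_gaussian n. inner_prod n z a) = 0"
    unfolding inner_prod_def using * by (subst Bochner_Integration.integral_sum) (auto intro!: sum.neutral)
qed

section \<open>Projection with shrunk noise\<close>

context closed_convex
begin

abbreviation "\<gamma> \<equiv> std_gaussian n"

lemma proj_self:
  assumes "y \<in> K" shows "proj n K y = y"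
proof -
  have "sqdist n y (proj n K y) \<le> 0" using proj_le[OF assms, of y] by (simp add: sqdist_def)
  then have "sqdist n y (proj n K y) = 0" by (intro antisym) simp_all
  then have "y = proj n K y" using assms sub proj_in by (intro sqdist_eq_0_imp_eq) auto
  then show ?thesis by simp
qed

definition shrunk :: "(nat \<Rightarrow> real) \<Rightarrow> (nat \<Rightarrow> real) \<Rightarrow> (nat \<Rightarrow> real)" where
  "shrunk \<mu> z = proj n K (\<lambda>i\<in>{..<n}. \<mu> i + z i / 8)"

lemma shrunk_in: "shrunk \<mu> z \<in> K"
  unfolding shrunk_def by (rule proj_in)

lemma measurable_shrunk [measurable]: "shrunk \<mu> \<in> rborel n \<rightarrow>\<^sub>M rborel n"
  unfolding shrunk_def by (intro measurable_compose[OF _ measurable_proj] measurable_rborelI) measurable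

text \<open>
  Completing the square turns the objective into a constant minus four times the squared distance
  of \<open>w\<close> to \<open>\<mu> + z / 8\<close>.
\<close>

lemma shrunk_maximal:
  assumes "w \<in> K"
  shows "inner_prod n z (\<lambda>i. w i - \<mu> i) - 4 * sqdist n w \<mu>
    \<le> inner_prod n z (\<lambda>i. shrunk \<mu> z i - \<mu> i) - 4 * sqdist n (shrunk \<mu> z) \<mu>"
proof -
  let ?c = "\<lambda>i\<in>{..<n}. \<mu> i + z i / 8"
  have *: "inner_prod n z (\<lambda>i. v i - \<mu> i) - 4 * sqdist n v \<mu> = (\<Sum>i<n. (z i)\<^sup>2) / 16 - 4 * sqdist n ?c v" for v
    unfolding inner_prod_def sqdist_def sum_distrib_left sum_divide_distrib sum_subtractf[symmetric]
    by (intro sum.cong) (auto simp: power2_eq_square field_simps)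
  show ?thesis unfolding * using proj_le[OF assms, of ?c] by (simp add: shrunk_def)
qed

lemma shrunk_variational:
  assumes "\<mu> \<in> K"
  shows "8 * sqdist n (shrunk \<mu> z) \<mu> \<le> inner_prod n z (\<lambda>i. shrunk \<mu> z i - \<mu> i)"
proof -
  let ?c = "\<lambda>i\<in>{..<n}. \<mu> i + z i / 8" and ?p = "shrunk \<mu> z"
  have "8 * sqdist n ?p \<mu> - inner_prod n z (\<lambda>i. ?p i - \<mu> i) = 8 * (\<Sum>i<n. (?c i - ?p i) * (\<mu> i - ?p i))"
    unfolding inner_prod_def sqdist_def sum_distrib_left sum_subtractf[symmetric]
    by (intro sum.cong) (auto simp: power2_eq_square field_simps)
  also have "\<dots> \<le> 0" using proj_variational[OF assms, of ?c] by (simp add: shrunk_def)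
  finally show ?thesis by simp
qed

lemma sqdist_shrunk_le:
  assumes "\<mu> \<in> K" shows "64 * sqdist n (shrunk \<mu> z) \<mu> \<le> (\<Sum>i<n. (z i)\<^sup>2)"
  using shrunk_variational[OF assms, of z] inner_prod_le[of "1/8" n z "shrunk \<mu> z" \<mu>] by (simp add: abs_le_iff)

lemma inner_prod_shrunk_le:
  assumes "\<mu> \<in> K" shows "\<bar>inner_prod n z (\<lambda>i. shrunk \<mu> z i - \<mu> i)\<bar> \<le> (\<Sum>i<n. (z i)\<^sup>2) / 8"
  using sqdist_shrunk_le[OF assms, of z] inner_prod_le[of "1/8" n z "shrunk \<mu> z" \<mu>] by simp

text \<open>
  The displacement of the projection grows at most linearly with the noise. With \<open>x\<close> and \<open>y\<close> the
  displacements for the noises \<open>z\<close> and \<open>z / 8\<close>, the two variational inequalities, each tested with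
  the other projection, add up to \<open>|x|\<^sup>2 + 8 |y|\<^sup>2 \<le> 9 (x \<bullet> y)\<close>; after Cauchy-Schwarz this is
  \<open>(|x| - |y|) (|x| - 8 |y|) \<le> 0\<close>.
\<close>

lemma sqdist_proj_le_shrunk:
  assumes "\<mu> \<in> K"
  shows "sqdist n (proj n K (vadd n z \<mu>)) \<mu> \<le> 64 * sqdist n (shrunk \<mu> z) \<mu>"
proof -
  let ?p = "proj n K (vadd n z \<mu>)" and ?q = "shrunk \<mu> z"
  let ?x = "\<lambda>i. ?p i - \<mu> i" and ?y = "\<lambda>i. ?q i - \<mu> i"
  have 1: "(\<Sum>i<n. (z i - ?x i) * (?y i - ?x i)) \<le> 0"
    using proj_variational[OF shrunk_in[of \<mu> z], of "vadd n z \<mu>"]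
    by (simp add: vadd_def algebra_simps)
  have "8 * (\<Sum>i<n. (z i / 8 - ?y i) * (?x i - ?y i)) \<le> 0"
    using proj_variational[OF proj_in[of "vadd n z \<mu>"], of "\<lambda>i\<in>{..<n}. \<mu> i + z i / 8"]
    by (simp add: shrunk_def algebra_simps)
  then have 2: "(\<Sum>i<n. (z i - 8 * ?y i) * (?x i - ?y i)) \<le> 0"
    unfolding sum_distrib_left by (simp add: algebra_simps)
  let ?a = "sqdist n ?p \<mu>" and ?b = "sqdist n ?q \<mu>" and ?c = "\<Sum>i<n. ?x i * ?y i"
  have "?a + 8 * ?b - 9 * ?c = (\<Sum>i<n. (z i - ?x i) * (?y i - ?x i)) + (\<Sum>i<n. (z i - 8 * ?y i) * (?x i - ?y i))"
    unfolding sqdist_def sum_distrib_left sum.distrib[symmetric] sum_subtractf[symmetric]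
    by (intro sum.cong) (auto simp: power2_eq_square algebra_simps)
  with 1 2 have le: "?a + 8 * ?b \<le> 9 * ?c" by linarith
  have "?c \<le> sqrt ?a * sqrt ?b"
    unfolding sqdist_def real_sqrt_mult[symmetric]
    by (intro real_le_rsqrt Cauchy_Schwarz_ineq_sum)
  then have "(sqrt ?a)\<^sup>2 + 8 * (sqrt ?b)\<^sup>2 \<le> 9 * (sqrt ?a * sqrt ?b)" using le by simp
  then have "(sqrt ?a - sqrt ?b) * (sqrt ?a - 8 * sqrt ?b) \<le> 0"
    by (simp add: algebra_simps power2_eq_square)
  then have "sqrt ?a \<le> 8 * sqrt ?b"
    by (smt (verit) mult_pos_pos real_sqrt_ge_zero sqdist_nonneg)
  then have "(sqrt ?a)\<^sup>2 \<le> (8 * sqrt ?b)\<^sup>2" by (intro power_mono) auto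
  then show ?thesis by (simp add: power_mult_distrib)
qed

text \<open>
  The gain is the expected maximum over \<open>w \<in> K\<close> of the objective in \<open>shrunk_maximal\<close>. Up to
  affine normalisation it is minus the expected squared distance of \<open>\<mu> + Z / 8\<close> to \<open>K\<close>, hence
  bounded above. The spread is the second moment about \<open>\<mu>\<close> of the prior.
\<close>

definition gain :: "(nat \<Rightarrow> real) \<Rightarrow> real" where
  "gain \<mu> = (LINT z|\<gamma>. inner_prod n z (\<lambda>i. shrunk \<mu> z i - \<mu> i) - 4 * sqdist n (shrunk \<mu> z) \<mu>)"

definition spread :: "(nat \<Rightarrow> real) \<Rightarrow> real" where
  "spread \<mu> = (LINT z|\<gamma>. sqdist n (shrunk \<mu> z) \<mu>)"

lemma measurable_sqdist_shrunk [measurable]: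
  assumes "\<mu> \<in> rspace n"
  shows "(\<lambda>z. sqdist n (shrunk \<mu> z) \<mu>) \<in> borel_measurable \<gamma>"
  using assms by (intro measurable_sqdist) (auto simp: space_rborel)

lemma integrable_sqdist_shrunk:
  assumes "\<mu> \<in> K" shows "integrable \<gamma> (\<lambda>z. sqdist n (shrunk \<mu> z) \<mu>)"
proof (rule Bochner_Integration.integrable_bound[OF integrable_std_gaussian_square])
  show "(\<lambda>z. sqdist n (shrunk \<mu> z) \<mu>) \<in> borel_measurable \<gamma>"
    using assms sub by (intro measurable_sqdist_shrunk) auto
  show "AE z in \<gamma>. norm (sqdist n (shrunk \<mu> z) \<mu>) \<le> norm (\<Sum>i<n. (z i)\<^sup>2)"
  proof (rule AE_I2)
    fix z
    show "norm (sqdist n (shrunk \<mu> z) \<mu>) \<le> norm (\<Sum>i<n. (z i)\<^sup>2)"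
      using sqdist_shrunk_le[OF assms, of z] sqdist_nonneg[of n "shrunk \<mu> z" \<mu>] by simp
  qed
qed

lemma integrable_inner_prod_shrunk:
  assumes "\<mu> \<in> K" shows "integrable \<gamma> (\<lambda>z. inner_prod n z (\<lambda>i. shrunk \<mu> z i - \<mu> i))"
proof (rule Bochner_Integration.integrable_bound[OF integrable_std_gaussian_square])
  show "AE z in \<gamma>. norm (inner_prod n z (\<lambda>i. shrunk \<mu> z i - \<mu> i)) \<le> norm (\<Sum>i<n. (z i)\<^sup>2)"
  proof (rule AE_I2)
    fix z :: "nat \<Rightarrow> real"
    have "0 \<le> (\<Sum>i<n. (z i)\<^sup>2)" by (simp add: sum_nonneg)
    then show "norm (inner_prod n z (\<lambda>i. shrunk \<mu> z i - \<mu> i)) \<le> norm (\<Sum>i<n. (z i)\<^sup>2)"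
      using inner_prod_shrunk_le[OF assms, of z] by simp
  qed
qed measurable

lemma integral_inner_prod_shrunk:
  assumes "\<mu> \<in> K"
  shows "(LINT z|\<gamma>. inner_prod n z (\<lambda>i. shrunk \<mu> z i - \<mu> i)) = gain \<mu> + 4 * spread \<mu>"
  unfolding gain_def spread_def using integrable_sqdist_shrunk[OF assms] integrable_inner_prod_shrunk[OF assms] by simp

lemma spread_nonneg: "0 \<le> spread \<mu>"
  unfolding spread_def by simp

text \<open>
  In the correlation of \<open>z\<close> with the displacement, \<open>shrunk_variational\<close> provides \<open>8\<close> times the
  spread, of which the penalty in the gain takes back only half.
\<close>

lemma spread_le_gain:
  assumes "\<mu> \<in> K" shows "4 * spread \<mu> \<le> gain \<mu>"
proof -
  have "8 * spread \<mu> \<le> (LINT z|\<gamma>. inner_prod n z (\<lambda>i. shrunk \<mu> z i - \<mu> i))"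
    unfolding spread_def integral_mult_right_zero[symmetric] using assms
    by (intro integral_mono integrable_inner_prod_shrunk shrunk_variational integrable_mult_right integrable_sqdist_shrunk)
  then show ?thesis by (simp add: integral_inner_prod_shrunk[OF assms])
qed

text \<open>
  The correlation of \<open>z\<close> with a displacement of small second moment is small. The free parameter
  \<open>t\<close> replaces an optimised Cauchy-Schwarz inequality.
\<close>

lemma gain_le:
  assumes "\<mu> \<in> K" "0 < t"
  shows "gain \<mu> \<le> t * (LINT z|\<gamma>. (\<Sum>i<n. (z i)\<^sup>2)) / 2 + spread \<mu> / (2 * t)"
proof -
  have "(LINT z|\<gamma>. inner_prod n z (\<lambda>i. shrunk \<mu> z i - \<mu> i))
     \<le> (LINT z|\<gamma>. t / 2 * (\<Sum>i<n. (z i)\<^sup>2) + sqdist n (shrunk \<mu> z) \<mu> * (1 / (2 * t)))"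
  proof (rule integral_mono)
    show "integrable \<gamma> (\<lambda>z. t / 2 * (\<Sum>i<n. (z i)\<^sup>2) + sqdist n (shrunk \<mu> z) \<mu> * (1 / (2 * t)))"
      using assms
      by (intro Bochner_Integration.integrable_add integrable_mult_right integrable_mult_left integrable_std_gaussian_square integrable_sqdist_shrunk)
    show "inner_prod n z (\<lambda>i. shrunk \<mu> z i - \<mu> i)
        \<le> t / 2 * (\<Sum>i<n. (z i)\<^sup>2) + sqdist n (shrunk \<mu> z) \<mu> * (1 / (2 * t))" for z
      using inner_prod_le[OF assms(2), of n z "shrunk \<mu> z" \<mu>] by simp
  qed (rule integrable_inner_prod_shrunk[OF assms(1)])
  also have "\<dots> = t / 2 * (LINT z|\<gamma>. (\<Sum>i<n. (z i)\<^sup>2)) + spread \<mu> * (1 / (2 * t))"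
    unfolding spread_def
    by (subst Bochner_Integration.integral_add)
      (auto intro!: integrable_mult_right integrable_mult_left integrable_std_gaussian_square integrable_sqdist_shrunk assms
        simp del: times_divide_eq_right)
  finally show ?thesis using spread_nonneg[of \<mu>] by (simp add: integral_inner_prod_shrunk[OF assms(1)])
qed

end

section \<open>Exponential moments of the prior\<close>

lemma measurable_vadd [measurable]:
  assumes [measurable]: "f \<in> M \<rightarrow>\<^sub>M rborel n" "g \<in> M \<rightarrow>\<^sub>M rborel n"
  shows "(\<lambda>x. vadd n (f x) (g x)) \<in> M \<rightarrow>\<^sub>M rborel n"
  unfolding vadd_def by (rule measurable_rborelI) measurable

lemma nn_integral_std_gaussian_shift:
  assumes "f \<in> borel_measurable (rborel n)"
  shows "(\<integral>\<^sup>+ z. f z \<partial>std_gaussian n)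
    = (\<integral>\<^sup>+ z. f (\<lambda>i\<in>{..<n}. z i + h i) * ennreal (exp (- inner_prod n z h - (\<Sum>i<n. (h i)\<^sup>2) / 2)) \<partial>std_gaussian n)"
proof -
  have "f \<in> borel_measurable (std_gaussian n)" using assms by measurable
  then show ?thesis
    unfolding std_gaussian_def inner_prod_def
    by (subst nn_integral_gaussian_on_shift[of "{..<n}" f h]) (simp_all add: mult.commute)
qed

context closed_convex
begin

text \<open>
  The exponent \<open>U\<close> is dominated by the infimum convolution with cost \<open>|x - y|\<^sup>2 / 4\<close> of \<open>V\<close>, where
  \<open>V y\<close> is the maximum over \<open>w \<in> K\<close> of \<open>y \<bullet> (w - \<mu>) - 4 |w - \<nu>|\<^sup>2\<close>: the choice of
  \<open>w = shrunk \<mu> x\<close> in this maximum leaves \<open>(x - y) \<bullet> (w - \<mu>) - |w - \<mu>|\<^sup>2\<close>, which is at most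
  \<open>|x - y|\<^sup>2 / 4\<close>. So property \<open>(\<tau>)\<close> applies to \<open>exp U\<close> and \<open>exp (- V)\<close>, and the mean of \<open>V\<close> is
  the gain at \<open>\<nu>\<close> because the linear term that recentres from \<open>\<mu>\<close> to \<open>\<nu>\<close> has mean zero.
\<close>

lemma exp_moment_shrunk_le:
  assumes \<mu>: "\<mu> \<in> K" and \<nu>: "\<nu> \<in> K"
  shows "(\<integral>\<^sup>+ z. ennreal (exp (inner_prod n z (\<lambda>i. shrunk \<mu> z i - \<mu> i) - sqdist n (shrunk \<mu> z) \<mu>
      - 4 * sqdist n (shrunk \<mu> z) \<nu>)) \<partial>\<gamma>) \<le> ennreal (exp (gain \<nu>))"
proof -
  have [measurable]: "\<mu> \<in> space (rborel n)" "\<nu> \<in> space (rborel n)" using \<mu> \<nu> sub by (auto simp: space_rborel)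
  define U where "U z = inner_prod n z (\<lambda>i. shrunk \<mu> z i - \<mu> i) - sqdist n (shrunk \<mu> z) \<mu> - 4 * sqdist n (shrunk \<mu> z) \<nu>" for z
  define V where "V z = (inner_prod n z (\<lambda>i. shrunk \<nu> z i - \<nu> i) - 4 * sqdist n (shrunk \<nu> z) \<nu>)
      + inner_prod n z (\<lambda>i. \<nu> i - \<mu> i)" for z
  have Um: "U \<in> borel_measurable \<gamma>" and Vm: "V \<in> borel_measurable \<gamma>"
    unfolding U_def V_def by measurable
  have UV: "U x - V y \<le> (\<Sum>i<n. (x i - y i)\<^sup>2) / 4" for x y
  proof -
    let ?w = "shrunk \<mu> x"
    have split: "inner_prod n y (\<lambda>i. ?w i - \<mu> i) = inner_prod n y (\<lambda>i. ?w i - \<nu> i) + inner_prod n y (\<lambda>i. \<nu> i - \<mu> i)"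
      unfolding inner_prod_def sum.distrib[symmetric] by (simp add: algebra_simps)
    have "inner_prod n y (\<lambda>i. ?w i - \<mu> i) - 4 * sqdist n ?w \<nu> \<le> V y"
      unfolding V_def split using shrunk_maximal[OF shrunk_in[of \<mu> x], of y \<nu>] by simp
    then have "U x - V y \<le> inner_prod n x (\<lambda>i. ?w i - \<mu> i) - inner_prod n y (\<lambda>i. ?w i - \<mu> i) - sqdist n ?w \<mu>"
      unfolding U_def by simp
    also have "\<dots> = (\<Sum>i<n. (x i - y i) * (?w i - \<mu> i) - (?w i - \<mu> i)\<^sup>2)"
      unfolding inner_prod_def sqdist_def sum_subtractf[symmetric] by (simp add: algebra_simps)
    also have "\<dots> \<le> (\<Sum>i<n. (x i - y i)\<^sup>2 / 4)"
    proof (rule sum_mono)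
      fix i
      have "a * b - b\<^sup>2 \<le> a\<^sup>2 / 4" for a b :: real
        using zero_le_power2[of "a / 2 - b"] by (simp add: power2_eq_square field_simps)
      then show "(x i - y i) * (?w i - \<mu> i) - (?w i - \<mu> i)\<^sup>2 \<le> (x i - y i)\<^sup>2 / 4" .
    qed
    finally show ?thesis by (simp add: sum_divide_distrib)
  qed
  have tau: "(\<integral>\<^sup>+ z. ennreal (exp (U z)) \<partial>\<gamma>) * (\<integral>\<^sup>+ z. ennreal (exp (- V z)) \<partial>\<gamma>) \<le> 1"
    unfolding std_gaussian_def
  proof (rule tau_gaussian_on)
    show "ennreal (exp (U x)) * ennreal (exp (- V y)) \<le> ennreal (exp ((\<Sum>i\<in>{..<n}. (x i - y i)\<^sup>2) / 4))" for x y
      using UV[of x y] by (simp add: ennreal_leI flip: ennreal_mult' exp_add)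
  qed (use Um Vm in \<open>simp_all add: std_gaussian_def\<close>)
  have Vint: "integrable \<gamma> V" and VE: "(LINT z|\<gamma>. V z) = gain \<nu>"
    unfolding V_def gain_def
    using integrable_inner_prod_shrunk[OF \<nu>] integrable_sqdist_shrunk[OF \<nu>]
      integrable_std_gaussian_inner_prod[of n] integral_std_gaussian_inner_prod[of n]
    by simp_all
  have "ennreal (exp (- gain \<nu>)) \<le> (\<integral>\<^sup>+ z. ennreal (exp (- V z)) \<partial>\<gamma>)"
    using exp_integral_le_nn_integral_exp[OF prob_space_std_gaussian, of n "\<lambda>z. - V z"] Vint VE by simp
  then have "(\<integral>\<^sup>+ z. ennreal (exp (U z)) \<partial>\<gamma>) * ennreal (exp (- gain \<nu>)) \<le> 1"
    using tau by (meson mult_left_mono order_trans zero_le)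
  then have "ennreal (exp (gain \<nu>)) * ((\<integral>\<^sup>+ z. ennreal (exp (U z)) \<partial>\<gamma>) * ennreal (exp (- gain \<nu>))) \<le> ennreal (exp (gain \<nu>)) * 1"
    by (intro mult_left_mono) auto
  also have "ennreal (exp (gain \<nu>)) * ((\<integral>\<^sup>+ z. ennreal (exp (U z)) \<partial>\<gamma>) * ennreal (exp (- gain \<nu>)))
     = (\<integral>\<^sup>+ z. ennreal (exp (U z)) \<partial>\<gamma>) * (ennreal (exp (gain \<nu>)) * ennreal (exp (- gain \<nu>)))"
    by (simp only: mult.left_commute)
  also have "ennreal (exp (gain \<nu>)) * ennreal (exp (- gain \<nu>)) = 1"
    by (simp flip: ennreal_mult' exp_add)
  finally show ?thesis by (simp add: U_def)
qed

section \<open>Bayes risk and the improvement of the gain\<close>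

definition risk :: "((nat \<Rightarrow> real) \<Rightarrow> (nat \<Rightarrow> real)) \<Rightarrow> (nat \<Rightarrow> real) \<Rightarrow> ennreal" where
  "risk g \<mu> = (\<integral>\<^sup>+ z. ennreal (sqdist n (g (vadd n z \<mu>)) \<mu>) \<partial>\<gamma>)"

text \<open>
  Here the estimator sees \<open>z + \<mu>\<close>, which carries no information on \<open>z'\<close>. Conditionally on \<open>z\<close> its
  value is a constant, and projecting that constant onto \<open>K\<close> can only bring it closer to the points
  of \<open>K\<close>; so \<open>exp_moment_shrunk_le\<close> applies after exchanging the integrals.
\<close>

lemma double_exponential_bound:
  assumes g[measurable]: "g \<in> rborel n \<rightarrow>\<^sub>M rborel n" and \<mu>: "\<mu> \<in> K" and c: "\<And>\<nu>. \<nu> \<in> K \<Longrightarrow> gain \<nu> \<le> c"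
  shows "(\<integral>\<^sup>+ z'. \<integral>\<^sup>+ z. ennreal (exp (inner_prod n z' (\<lambda>i. shrunk \<mu> z' i - \<mu> i) - sqdist n (shrunk \<mu> z') \<mu>
      - 4 * sqdist n (shrunk \<mu> z') (g (vadd n z \<mu>)))) \<partial>\<gamma> \<partial>\<gamma>) \<le> ennreal (exp c)"
proof -
  interpret G: prob_space \<gamma> by (rule prob_space_std_gaussian)
  have ps: "pair_sigma_finite \<gamma> \<gamma>" by standard
  have [measurable]: "\<mu> \<in> space (rborel n)" using \<mu> sub by (auto simp: space_rborel)
  let ?f = "\<lambda>(z', z). ennreal (exp (inner_prod n z' (\<lambda>i. shrunk \<mu> z' i - \<mu> i) - sqdist n (shrunk \<mu> z') \<mu>
      - 4 * sqdist n (shrunk \<mu> z') (g (vadd n z \<mu>))))"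
  have [measurable]: "(\<lambda>x. shrunk \<mu> (fst x) i) \<in> borel_measurable (\<gamma> \<Otimes>\<^sub>M \<gamma>)"
     "(\<lambda>x. fst x i) \<in> borel_measurable (\<gamma> \<Otimes>\<^sub>M \<gamma>)" if "i < n" for i
    using that by measurable
  have fm: "?f \<in> borel_measurable (\<gamma> \<Otimes>\<^sub>M \<gamma>)" unfolding split_beta' by measurable
  have "(\<integral>\<^sup>+ z'. \<integral>\<^sup>+ z. ?f (z', z) \<partial>\<gamma> \<partial>\<gamma>) = (\<integral>\<^sup>+ z. \<integral>\<^sup>+ z'. ?f (z', z) \<partial>\<gamma> \<partial>\<gamma>)"
    by (rule pair_sigma_finite.Fubini'[OF ps]) (use fm in simp)
  also have "\<dots> \<le> (\<integral>\<^sup>+ z. ennreal (exp c) \<partial>\<gamma>)"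
  proof (rule nn_integral_mono)
    fix z assume "z \<in> space \<gamma>"
    let ?y = "g (vadd n z \<mu>)"
    have "(\<integral>\<^sup>+ z'. ?f (z', z) \<partial>\<gamma>) \<le> (\<integral>\<^sup>+ z'. ennreal (exp (inner_prod n z' (\<lambda>i. shrunk \<mu> z' i - \<mu> i)
        - sqdist n (shrunk \<mu> z') \<mu> - 4 * sqdist n (shrunk \<mu> z') (proj n K ?y))) \<partial>\<gamma>)"
    proof (rule nn_integral_mono)
      fix z'
      have "sqdist n (shrunk \<mu> z') (proj n K ?y) \<le> sqdist n (shrunk \<mu> z') ?y"
        using proj_nonexpansive[of "shrunk \<mu> z'" ?y] by (simp add: proj_self shrunk_in)
      then show "?f (z', z) \<le> ennreal (exp (inner_prod n z' (\<lambda>i. shrunk \<mu> z' i - \<mu> i)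
        - sqdist n (shrunk \<mu> z') \<mu> - 4 * sqdist n (shrunk \<mu> z') (proj n K ?y)))"
        by (simp add: ennreal_leI)
    qed
    also have "\<dots> \<le> ennreal (exp (gain (proj n K ?y)))" by (rule exp_moment_shrunk_le[OF \<mu> proj_in])
    also have "\<dots> \<le> ennreal (exp c)" using c[OF proj_in] by (simp add: ennreal_leI)
    finally show "(\<integral>\<^sup>+ z'. ?f (z', z) \<partial>\<gamma>) \<le> ennreal (exp c)" .
  qed
  also have "\<dots> = ennreal (exp c)" by (simp add: G.emeasure_space_1)
  finally show ?thesis by simp
qed

text \<open>
  Translating the noise by \<open>p - \<mu>\<close> lets the estimator see \<open>z + p\<close> instead of \<open>z + \<mu>\<close>. The
  logarithm of the density of this change of measure has mean \<open>- |p - \<mu>|\<^sup>2 / 2\<close>, and Jensen's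
  inequality moves the mean into the exponent, where the risk at \<open>p\<close> appears.
\<close>

lemma exponential_risk_lower_bound:
  assumes g[measurable]: "g \<in> rborel n \<rightarrow>\<^sub>M rborel n" and \<mu>: "\<mu> \<in> K" and p: "p \<in> K"
    and b: "0 \<le> b" and risk: "risk g p \<le> ennreal b"
  shows "ennreal (exp (a - 4 * b - sqdist n p \<mu> / 2)) \<le> (\<integral>\<^sup>+ z. ennreal (exp (a - 4 * sqdist n p (g (vadd n z \<mu>)))) \<partial>\<gamma>)"
proof -
  have [measurable]: "\<mu> \<in> space (rborel n)" "p \<in> space (rborel n)" using \<mu> p sub by (auto simp: space_rborel)
  define h where "h = (\<lambda>i. p i - \<mu> i)"
  have h2: "(\<Sum>i<n. (h i)\<^sup>2) = sqdist n p \<mu>" by (simp add: h_def sqdist_def)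
  have shift: "vadd n (\<lambda>i\<in>{..<n}. z i + h i) \<mu> = vadd n z p" for z
    by (auto simp: vadd_def h_def fun_eq_iff)
  define D where "D z = sqdist n (g (vadd n z p)) p" for z
  have [measurable]: "D \<in> borel_measurable \<gamma>" unfolding D_def by measurable
  have Dint: "integrable \<gamma> D" and DE: "(LINT z|\<gamma>. D z) \<le> b"
  proof -
    have le: "(\<integral>\<^sup>+ z. ennreal (D z) \<partial>\<gamma>) \<le> ennreal b" using risk by (simp add: risk_def D_def)
    show int: "integrable \<gamma> D"
    proof (rule integrableI_nonneg)
      show "(\<integral>\<^sup>+ z. ennreal (D z) \<partial>\<gamma>) < \<infinity>"
        using le by (rule le_less_trans) simp
    qed (simp_all add: D_def)
    have "(\<integral>\<^sup>+ z. ennreal (D z) \<partial>\<gamma>) = ennreal (LINT z|\<gamma>. D z)"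
      by (rule nn_integral_eq_integral[OF int]) (simp add: D_def)
    then show "(LINT z|\<gamma>. D z) \<le> b" using le b by simp
  qed
  interpret G: prob_space \<gamma> by (rule prob_space_std_gaussian)
  let ?X = "\<lambda>z. (a - 4 * D z) + (- inner_prod n z h - sqdist n p \<mu> / 2)"
  have Xint: "integrable \<gamma> ?X"
    using Dint integrable_std_gaussian_inner_prod[of n h] by simp
  have XE: "(LINT z|\<gamma>. ?X z) = a - 4 * (LINT z|\<gamma>. D z) - sqdist n p \<mu> / 2"
    using Dint integrable_std_gaussian_inner_prod[of n h] integral_std_gaussian_inner_prod[of n h]
    by (simp add: G.prob_space)
  have "ennreal (exp (a - 4 * b - sqdist n p \<mu> / 2)) \<le> ennreal (exp (LINT z|\<gamma>. ?X z))"
    unfolding XE using DE by (simp add: ennreal_leI)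
  also have "\<dots> \<le> (\<integral>\<^sup>+ z. ennreal (exp (?X z)) \<partial>\<gamma>)"
    by (rule exp_integral_le_nn_integral_exp[OF prob_space_std_gaussian Xint])
  also have "\<dots> = (\<integral>\<^sup>+ z. ennreal (exp (a - 4 * sqdist n p (g (vadd n z \<mu>)))) \<partial>\<gamma>)"
    by (subst (2) nn_integral_std_gaussian_shift[where h = h])
      (simp_all add: shift h2 D_def sqdist_commute[of n p] flip: ennreal_mult' exp_add)
  finally show ?thesis .
qed

lemma sqdist_proj_vadd_le:
  assumes \<mu>: "\<mu> \<in> K"
  shows "sqdist n (proj n K (vadd n z p)) p \<le> 256 * sqdist n (shrunk \<mu> z) \<mu> + 6 * sqdist n p \<mu>"
proof -
  let ?P = "proj n K (vadd n z p)" and ?Q = "proj n K (vadd n z \<mu>)"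
  have "sqdist n ?P ?Q \<le> sqdist n p \<mu>"
    using proj_nonexpansive[of "vadd n z p" "vadd n z \<mu>"] by (simp add: sqdist_def vadd_def)
  then show ?thesis
    using sqdist_triangle_double[of n ?P p ?Q] sqdist_triangle_double[of n ?Q p \<mu>]
      sqdist_proj_le_shrunk[OF \<mu>, of z] sqdist_commute[of n \<mu> p] by linarith
qed

lemma risk_proj_le:
  assumes \<mu>: "\<mu> \<in> K"
  shows "risk (proj n K) p \<le> ennreal (256 * spread \<mu> + 6 * sqdist n p \<mu>)"
proof -
  interpret G: prob_space \<gamma> by (rule prob_space_std_gaussian)
  let ?B = "\<lambda>z. 256 * sqdist n (shrunk \<mu> z) \<mu> + 6 * sqdist n p \<mu>"
  have int: "integrable \<gamma> ?B" using integrable_sqdist_shrunk[OF \<mu>] by simp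
  have "risk (proj n K) p \<le> (\<integral>\<^sup>+ z. ennreal (?B z) \<partial>\<gamma>)"
    unfolding risk_def by (intro nn_integral_mono ennreal_leI sqdist_proj_vadd_le \<mu>)
  also have "\<dots> = ennreal (LINT z|\<gamma>. ?B z)" using int by (intro nn_integral_eq_integral) auto
  also have "(LINT z|\<gamma>. ?B z) = 256 * spread \<mu> + 6 * sqdist n p \<mu>"
    using integrable_sqdist_shrunk[OF \<mu>] by (simp add: spread_def G.prob_space)
  finally show ?thesis .
qed

text \<open>
  The prior draws \<open>p = shrunk \<mu> z\<close>, and \<open>b z\<close> bounds the assumed risk of \<open>g\<close> there. Its
  contribution is \<open>4 E b = 4 * 262 / 524\<close> times the spread, that is, twice the spread, so that
  \<open>4 - 1 - 1 / 2 - 2 = 1 / 2\<close> of the spread remains.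
\<close>

lemma gain_improvement:
  assumes g: "g \<in> rborel n \<rightarrow>\<^sub>M rborel n"
    and dom: "\<And>p. p \<in> K \<Longrightarrow> risk g p \<le> ennreal (1 / 524) * risk (proj n K) p"
    and c: "\<And>\<nu>. \<nu> \<in> K \<Longrightarrow> gain \<nu> \<le> c" and \<mu>: "\<mu> \<in> K"
  shows "gain \<mu> + spread \<mu> / 2 \<le> c"
proof -
  interpret G: prob_space \<gamma> by (rule prob_space_std_gaussian)
  let ?A = "\<lambda>z. inner_prod n z (\<lambda>i. shrunk \<mu> z i - \<mu> i) - sqdist n (shrunk \<mu> z) \<mu>"
  define b where "b z = (256 * spread \<mu> + 6 * sqdist n (shrunk \<mu> z) \<mu>) / 524" for z
  have b0: "0 \<le> b z" for z by (simp add: b_def spread_nonneg)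
  have rb: "risk g (shrunk \<mu> z) \<le> ennreal (b z)" for z
  proof -
    have "risk g (shrunk \<mu> z) \<le> ennreal (1 / 524) * risk (proj n K) (shrunk \<mu> z)" by (rule dom[OF shrunk_in])
    also have "\<dots> \<le> ennreal (1 / 524) * ennreal (256 * spread \<mu> + 6 * sqdist n (shrunk \<mu> z) \<mu>)"
      by (intro mult_left_mono risk_proj_le \<mu>) simp
    also have "\<dots> = ennreal (b z)" by (subst ennreal_mult'[symmetric]) (simp_all add: b_def)
    finally show ?thesis .
  qed
  let ?X = "\<lambda>z. ?A z - 4 * b z - sqdist n (shrunk \<mu> z) \<mu> / 2"
  have Xint: "integrable \<gamma> ?X"
    unfolding b_def using integrable_inner_prod_shrunk[OF \<mu>] integrable_sqdist_shrunk[OF \<mu>] by simp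
  have XE: "(LINT z|\<gamma>. ?X z) = gain \<mu> + spread \<mu> / 2"
    unfolding b_def using integrable_inner_prod_shrunk[OF \<mu>] integrable_sqdist_shrunk[OF \<mu>]
    by (simp add: integral_inner_prod_shrunk[OF \<mu>] G.prob_space flip: spread_def)
  have "ennreal (exp (gain \<mu> + spread \<mu> / 2)) \<le> (\<integral>\<^sup>+ z. ennreal (exp (?X z)) \<partial>\<gamma>)"
    using exp_integral_le_nn_integral_exp[OF prob_space_std_gaussian Xint] unfolding XE .
  also have "\<dots> \<le> (\<integral>\<^sup>+ z'. \<integral>\<^sup>+ z. ennreal (exp (?A z' - 4 * sqdist n (shrunk \<mu> z') (g (vadd n z \<mu>)))) \<partial>\<gamma> \<partial>\<gamma>)"
    by (intro nn_integral_mono exponential_risk_lower_bound[OF g \<mu> shrunk_in b0 rb])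
  also have "\<dots> \<le> ennreal (exp c)" by (rule double_exponential_bound[OF g \<mu> c])
  finally show ?thesis by simp
qed

text \<open>
  The supremum of the gain need not be attained when \<open>K\<close> is unbounded; an approximate maximiser
  has a spread below \<open>2 * e\<close>, and \<open>t\<close> and \<open>e\<close> are chosen to keep each error term at most a quarter
  of the supremum.
\<close>

lemma ex_risk_ge:
  assumes g: "g \<in> rborel n \<rightarrow>\<^sub>M rborel n"
  shows "\<exists>\<mu>\<in>K. risk g \<mu> \<ge> ennreal (1 / 524) * risk (proj n K) \<mu>"
proof (rule ccontr)
  assume "\<not> ?thesis"
  then have less: "risk g p < ennreal (1 / 524) * risk (proj n K) p" if "p \<in> K" for p
    using that by (auto simp: not_le)
  define m where "m = (LINT z|\<gamma>. (\<Sum>i<n. (z i)\<^sup>2))"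
  have m0: "0 \<le> m" unfolding m_def by (simp add: sum_nonneg)
  define c where "c = Sup (gain ` K)"
  have spread_m: "64 * spread \<nu> \<le> m" if "\<nu> \<in> K" for \<nu>
    unfolding spread_def m_def integral_mult_right_zero[symmetric]
    by (intro integral_mono sqdist_shrunk_le integrable_mult_right integrable_sqdist_shrunk integrable_std_gaussian_square that)
  have bdd: "bdd_above (gain ` K)"
  proof (rule bdd_aboveI2)
    fix \<nu> assume "\<nu> \<in> K"
    then show "gain \<nu> \<le> m" using gain_le[of \<nu> "1/8"] spread_m[of \<nu>] m0 by (simp add: m_def)
  qed
  have gain_c: "gain \<nu> \<le> c" if "\<nu> \<in> K" for \<nu>
    unfolding c_def using bdd that by (auto intro: cSup_upper)
  have improve: "gain \<mu> + spread \<mu> / 2 \<le> c" if "\<mu> \<in> K" for \<mu>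
    using gain_improvement[OF g less_imp_le[OF less] gain_c that] by simp
  have "c \<le> 0"
  proof (rule ccontr)
    assume "\<not> c \<le> 0"
    then have c0: "0 < c" by simp
    define t where "t = c / (2 * (m + 1))"
    have t0: "0 < t" using c0 m0 by (simp add: t_def)
    have tm: "t * m / 2 \<le> c / 4" using c0 m0 by (simp add: t_def field_simps)
    define e where "e = min (c / 4) (t * c / 4)"
    have e0: "0 < e" using c0 t0 by (simp add: e_def)
    obtain \<mu> where \<mu>: "\<mu> \<in> K" "c - e < gain \<mu>"
      using less_cSup_iff[of "gain ` K" "c - e"] bdd nonempty e0 unfolding c_def by auto
    have "spread \<mu> < 2 * e" using improve[OF \<mu>(1)] \<mu>(2) by simp
    then have "spread \<mu> / (2 * t) < e / t" using t0 by (simp add: field_simps)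
    also have "e / t \<le> c / 4" using t0 by (simp add: e_def field_simps min_le_iff_disj)
    finally have "gain \<mu> < c / 4 + c / 4" using gain_le[OF \<mu>(1) t0] tm by (simp add: m_def)
    moreover have "e \<le> c / 4" by (simp add: e_def)
    ultimately show False using \<mu>(2) c0 by simp
  qed
  obtain \<mu> where \<mu>: "\<mu> \<in> K" using nonempty by blast
  have "spread \<mu> = 0"
    using spread_le_gain[OF \<mu>] gain_c[OF \<mu>] spread_nonneg[of \<mu>] \<open>c \<le> 0\<close> by simp
  then have "risk (proj n K) \<mu> = 0" using risk_proj_le[OF \<mu>, of \<mu>] by (simp add: sqdist_def)
  then show False using less[OF \<mu>] by simp
qed

end

theorem theorem1p4:
  shows "\<exists>C::real. C > 0 \<and>
    (\<forall>(n::nat) (K::(nat \<Rightarrow> real) set) (g::(nat \<Rightarrow> real) \<Rightarrow> (nat \<Rightarrow> real)).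
      n \<ge> 1 \<longrightarrow> K \<subseteq> rspace n \<longrightarrow> K \<noteq> {} \<longrightarrow> closedin (rtop n) K \<longrightarrow> rconvex n K \<longrightarrow>
      g \<in> rborel n \<rightarrow>\<^sub>M rborel n \<longrightarrow>
      (\<exists>\<mu>\<in>K.
        (\<integral>\<^sup>+ z. ennreal ((enorm n (vminus n (g (vadd n z \<mu>)) \<mu>))\<^sup>2) \<partial>std_gaussian n)
        \<ge> ennreal C *
          (\<integral>\<^sup>+ z. ennreal ((enorm n (vminus n (proj n K (vadd n z \<mu>)) \<mu>))\<^sup>2) \<partial>std_gaussian n)))"
proof (intro exI[of _ "1 / 524 :: real"] conjI allI impI)
  fix n K g
  assume "K \<subseteq> rspace n" "K \<noteq> {}" "closedin (rtop n) K" "rconvex n K" and g: "g \<in> rborel n \<rightarrow>\<^sub>M rborel n"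
  then interpret closed_convex n K by unfold_locales
  show "\<exists>\<mu>\<in>K.
        (\<integral>\<^sup>+ z. ennreal ((enorm n (vminus n (g (vadd n z \<mu>)) \<mu>))\<^sup>2) \<partial>std_gaussian n)
        \<ge> ennreal (1 / 524) *
          (\<integral>\<^sup>+ z. ennreal ((enorm n (vminus n (proj n K (vadd n z \<mu>)) \<mu>))\<^sup>2) \<partial>std_gaussian n)"
    using ex_risk_ge[OF g] unfolding risk_def enorm_vminus_square .
qed simp

end
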